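(* Let $M_1,M_2$ be almost-entropic matroids with disjoint ground sets, and choose ordered independent sets $I_1=(x_1,\dots,x_k)$ in $M_1$ and $I_2=(y_1,\dots,y_k)$ in $M_2$. Starting from $M_1\oplus M_2$, identify $x_j$ with $y_j$ successively for $j=1,\dots,k$, by the principal-extension--contraction--deletion operation defined in the context, retaining $x_j$ as the common label. Then the resulting matroid $W$ is almost entropic and contains natural restrictions isomorphic to both $M_1$ and $M_2$: the restriction of $W$ to $E(M_1)$ is $M_1$, and the restriction of $W$ to $(E(M_2)\setminus\{y_1,\dots,y_k\})\cup\{x_1,\dots,x_k\}$ is isomorphic to $M_2$ under the relabelling $x_j\mapsto y_j$ fixing the other elements. If moreover $M_1$ and $M_2$ both have rank $r$, $k=r$, and $I_1$, $I_2$ are bases of $M_1$, $M_2$ respectively, then $r(W)=r$ and both factor restrictions are spanning in $W$.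
   Context: Principal extension. For a matroid $M$ and $L\subseteq E(M)$, the principal extension $M+_L z$ adds a new element $z$ freely to the flat $\operatorname{cl}_M(L)$: for $S\subseteq E(M)$, $r(S\cup\{z\})=r_M(S)$ if $L\subseteq \operatorname{cl}_M(S)$ and $r(S\cup\{z\})=r_M(S)+1$ otherwise. Identification. To identify $x$ with $y$, where $\{x,y\}$ is independent: form the principal extension adding a new point $e$ freely on the rank-two flat $\operatorname{cl}(\{x,y\})$, contract $e$, and delete $y$; the surviving point $x$ represents the identification. Almost entropic: for jointly distributed discrete random variables $(X_e)_{e\in E}$ the function $h(A)=H((X_e)_{e\in A})$ on $2^E$ (Shannon entropy) is called an entropic polymatroid. The closed conic hull (in $\mathbb R^{2^E}$) of entropic polymatroids on $E$ is the almost-entropic cone. A matroid on $E$ is almost entropic if its rank function lies in that cone. The restriction $M|S$ is obtained by deleting $E(M)\setminus S$; it is spanning if $r_M(S)=r(M)$. *)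

theory Defs
  imports "HOL-Probability.Probability"
begin

section \<open>Matroids\<close>

text \<open>
  A matroid is a finite ground set together with its rank function. So that matroids with the
  same ground set and the same ranks are equal, the rank function is constrained on subsets
  of the ground set only and is \<^const>\<open>undefined\<close> elsewhere (\<^const>\<open>extensional\<close>).
\<close>

datatype 'a ranked_set = Ranked_Set (ground: "'a set") (rk: "'a set \<Rightarrow> nat")

definition mk_ranked :: "'a set \<Rightarrow> ('a set \<Rightarrow> nat) \<Rightarrow> 'a ranked_set" where
  "mk_ranked E f = Ranked_Set E (restrict f (Pow E))"

definition matroid :: "'a ranked_set \<Rightarrow> bool" where
  "matroid M \<longleftrightarrow>
     finite (ground M) \<and>
     rk M \<in> extensional (Pow (ground M)) \<and>
     (\<forall>S. S \<subseteq> ground M \<longrightarrow> rk M S \<le> card S) \<and>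
     (\<forall>S T. S \<subseteq> T \<and> T \<subseteq> ground M \<longrightarrow> rk M S \<le> rk M T) \<and>
     (\<forall>S T. S \<subseteq> ground M \<and> T \<subseteq> ground M \<longrightarrow>
        rk M (S \<union> T) + rk M (S \<inter> T) \<le> rk M S + rk M T)"

definition total_rank :: "'a ranked_set \<Rightarrow> nat" where
  "total_rank M = rk M (ground M)"

definition independent_in :: "'a ranked_set \<Rightarrow> 'a set \<Rightarrow> bool" where
  "independent_in M S \<longleftrightarrow> S \<subseteq> ground M \<and> rk M S = card S"

definition basis_of :: "'a ranked_set \<Rightarrow> 'a set \<Rightarrow> bool" where
  "basis_of M B \<longleftrightarrow>
     independent_in M B \<and> (\<forall>B'. independent_in M B' \<and> B \<subseteq> B' \<longrightarrow> B' = B)"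

definition spanning_in :: "'a ranked_set \<Rightarrow> 'a set \<Rightarrow> bool" where
  "spanning_in M S \<longleftrightarrow> S \<subseteq> ground M \<and> rk M S = total_rank M"

definition cl :: "'a ranked_set \<Rightarrow> 'a set \<Rightarrow> 'a set" where
  "cl M S = {e \<in> ground M. rk M (insert e S) = rk M S}"

definition delete :: "'a ranked_set \<Rightarrow> 'a set \<Rightarrow> 'a ranked_set" where
  "delete M D = mk_ranked (ground M - D) (rk M)"

definition contract :: "'a ranked_set \<Rightarrow> 'a set \<Rightarrow> 'a ranked_set" where
  "contract M C = mk_ranked (ground M - C) (\<lambda>S. rk M (S \<union> C) - rk M C)"

definition restriction :: "'a ranked_set \<Rightarrow> 'a set \<Rightarrow> 'a ranked_set" where
  "restriction M S = delete M (ground M - S)"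

text \<open>Only meaningful for disjoint ground sets.\<close>

definition direct_sum :: "'a ranked_set \<Rightarrow> 'a ranked_set \<Rightarrow> 'a ranked_set" where
  "direct_sum M N = mk_ranked (ground M \<union> ground N)
     (\<lambda>S. rk M (S \<inter> ground M) + rk N (S \<inter> ground N))"

text \<open>Only meaningful for maps that are injective on the ground set.\<close>

definition relabel :: "('a \<Rightarrow> 'b) \<Rightarrow> 'a ranked_set \<Rightarrow> 'b ranked_set" where
  "relabel f M = mk_ranked (f ` ground M) (\<lambda>S. rk M {e \<in> ground M. f e \<in> S})"

definition matroid_iso :: "('a \<Rightarrow> 'b) \<Rightarrow> 'a ranked_set \<Rightarrow> 'b ranked_set \<Rightarrow> bool" where
  "matroid_iso f M N \<longleftrightarrow>
     bij_betw f (ground M) (ground N) \<and> (\<forall>S. S \<subseteq> ground M \<longrightarrow> rk N (f ` S) = rk M S)"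

section \<open>Principal extension and identification\<close>

text \<open>Only meaningful for \<open>L \<subseteq> ground M\<close> and \<open>z \<notin> ground M\<close>.\<close>

definition principal_extension :: "'a ranked_set \<Rightarrow> 'a set \<Rightarrow> 'a \<Rightarrow> 'a ranked_set" where
  "principal_extension M L z = mk_ranked (insert z (ground M))
     (\<lambda>S. if z \<notin> S then rk M S
          else if L \<subseteq> cl M (S - {z}) then rk M (S - {z})
          else rk M (S - {z}) + 1)"

text \<open>
  The type of labels need not contain an unused element, so the new point is \<^const>\<open>None\<close>,
  every old element \<open>a\<close> being renamed to \<open>Some a\<close> during the construction.
  The operation is only meaningful if \<open>{x, y}\<close> is an independent set with \<open>x \<noteq> y\<close>.
\<close>

definition identify :: "'a ranked_set \<Rightarrow> 'a \<Rightarrow> 'a \<Rightarrow> 'a ranked_set" where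
  "identify M x y =
     (let M' = relabel Some M;
          N = principal_extension M' (cl M' {Some x, Some y}) None
      in relabel the (delete (contract N {None}) {Some y}))"

definition identify_list :: "'a ranked_set \<Rightarrow> 'a list \<Rightarrow> 'a list \<Rightarrow> 'a ranked_set" where
  "identify_list M xs ys = fold (\<lambda>(x, y) N. identify N x y) (zip xs ys) M"

section \<open>Almost entropic matroids\<close>

text \<open>
  Entropy depends only on the joint law, and the values of a discrete random variable can be
  renamed to natural numbers. Hence a family of jointly distributed discrete random variables is
  given by its joint law \<open>p\<close>, the variable \<open>X\<^sub>e\<close> being the coordinate \<open>\<omega> \<mapsto> \<omega> e\<close> and the
  tuple \<open>(X\<^sub>e)\<close> over \<open>e \<in> A\<close> being \<open>\<omega> \<mapsto> restrict \<omega> A\<close>. Infinitely many values are allowed; the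
  condition on \<open>f\<close> says that the entropy is finite (\<open>f\<close> is the mass function of the tuple).
\<close>

definition entropic :: "'a set \<Rightarrow> ('a set \<Rightarrow> real) \<Rightarrow> bool" where
  "entropic E h \<longleftrightarrow>
     h \<in> extensional (Pow E) \<and>
     (\<exists>p :: ('a \<Rightarrow> nat) pmf. \<forall>A\<in>Pow E.
        let S = count_space (A \<rightarrow>\<^sub>E (UNIV :: nat set)); X = (\<lambda>\<omega>. restrict \<omega> A)
        in (\<exists>f. information_space.finite_entropy (measure_pmf p) 2 S X f) \<and>
           h A = prob_space.entropy (measure_pmf p) 2 S X)"

definition entropic_conic_hull :: "'a set \<Rightarrow> ('a set \<Rightarrow> real) set" where
  "entropic_conic_hull E =
     {h. \<exists>(n :: nat) c g. (\<forall>i<n. 0 \<le> c i \<and> entropic E (g i)) \<and>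
           h = (\<lambda>A\<in>Pow E. \<Sum>i<n. c i * g i A)}"

text \<open>
  The points of \<open>powertop_real (Pow E)\<close> are the functions in \<open>extensional (Pow E)\<close>.
\<close>

definition almost_entropic_cone :: "'a set \<Rightarrow> ('a set \<Rightarrow> real) set" where
  "almost_entropic_cone E = powertop_real (Pow E) closure_of entropic_conic_hull E"

definition almost_entropic :: "'a ranked_set \<Rightarrow> bool" where
  "almost_entropic M \<longleftrightarrow>
     matroid M \<and> (\<lambda>A\<in>Pow (ground M). real (rk M A)) \<in> almost_entropic_cone (ground M)"

end

theory Submission
  imports Defs "HOL-Combinatorics.Multiset_Permutations"
begin

text \<open>
  Identifying \<open>x\<close> with \<open>y\<close> replaces the rank of \<open>S\<close> by
  \<open>min (r S) (r (S \<union> {x, y}) - 1)\<close> (lemma \<open>rk_identify\<close>). Two things have to be shown.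

  The first is that this operation preserves almost entropic functions. More generally, if \<open>h\<close> is almost entropic
  and \<open>0 \<le> t \<le> h L\<close>, then so is \<open>min (h A) (h (A \<union> L) - t)\<close> (lemma
  \<open>principal_quotient_in_almost_entropic_cone\<close>). The idea is to condition on a random hash with \<open>exp t\<close>
  values of the variables indexed by \<open>L\<close>. Such a hash is nearly independent of the variables indexed
  by \<open>A\<close> as long as these leave at least the entropy \<open>t\<close> in \<open>L\<close>; otherwise the hash together with \<open>A\<close>
  determines nearly everything in \<open>L\<close>. Conditioning yields an average of entropy functions, which is a point of
  the cone. This is exact up to a constant for families of variables that are quasi-uniform, that is, uniform with classes of
  equal size. A family of variables of finite support is turned into a quasi-uniform one, with \<open>N\<close> times the
  entropies up to \<open>o(N)\<close>, by passing to a random arrangement of about \<open>N\<close> outcomes in the right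
  proportions: the symmetric group acts transitively on the arrangements, and the entropies
  are logarithms of multinomial coefficients. Infinitely many values are reduced to finitely many by dominated convergence. So
  every almost entropic function is a limit of rescaled quasi-uniform ones (lemma
  \<open>almost_entropic_cone_imp_quasi_uniform_limit\<close>), to which hashing applies with
  an error that vanishes after rescaling (lemma \<open>quotient_of_quasi_uniform\<close>).

  The second is that the identifications do not disturb the two factors. Before each step the \<open>y\<close> that are still
  to be identified are independent over the first factor, and the remaining \<open>x\<close> are independent over the
  second (lemma \<open>identification_stage_Suc\<close>). So no subset of the first factor spans the
  next \<open>y\<close>, and its rank is unchanged; in the second factor \<open>x\<close> takes the place of \<open>y\<close> in the same way.
\<close>

section \<open>Entropy as an expectation, and the almost entropic cone\<close>

text \<open>
  Entropy in nats, as the mean of \<open>- ln\<close> of the probability of the class of the outcome. Classes are taken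
  under equality of all \<open>X e\<close> with \<open>e \<in> A\<close>, so only the partition of the sample space matters, the
  sample space may be of any type, and no space of tuples has to be mentioned.
\<close>

definition joint_entropy :: "'w pmf \<Rightarrow> ('a \<Rightarrow> 'w \<Rightarrow> nat) \<Rightarrow> 'a set \<Rightarrow> real" where
  "joint_entropy p X A =
     measure_pmf.expectation p (\<lambda>v. - ln (measure_pmf.prob p {w. \<forall>e\<in>A. X e w = X e v}))"

lemma distributed_pmf_tuple:
  fixes p :: "('a \<Rightarrow> nat) pmf"
  assumes A: "finite A"
  shows "distributed (measure_pmf p) (count_space (A \<rightarrow>\<^sub>E (UNIV :: nat set))) (\<lambda>\<omega>. restrict \<omega> A)
           (\<lambda>x. ennreal (measure_pmf.prob p {\<omega>. restrict \<omega> A = x}))"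
proof -
  let ?S = "count_space (A \<rightarrow>\<^sub>E (UNIV :: nat set))"
  have cnt: "countable (A \<rightarrow>\<^sub>E (UNIV :: nat set))"
    by (rule countable_PiE[OF A]) auto
  have "distr (measure_pmf p) ?S (\<lambda>\<omega>. restrict \<omega> A) =
        density ?S (\<lambda>x. ennreal (measure_pmf.prob p {\<omega>. restrict \<omega> A = x}))"
  proof (rule measure_eqI_countable)
    fix x assume x: "x \<in> A \<rightarrow>\<^sub>E (UNIV :: nat set)"
    have "emeasure (distr (measure_pmf p) ?S (\<lambda>\<omega>. restrict \<omega> A)) {x} =
          emeasure (measure_pmf p) {\<omega>. restrict \<omega> A = x}"
      using x by (subst emeasure_distr) (auto simp: vimage_def)
    also have "\<dots> = ennreal (measure_pmf.prob p {\<omega>. restrict \<omega> A = x})"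
      by (simp add: measure_pmf.emeasure_eq_measure)
    also have "\<dots> = emeasure (density ?S (\<lambda>x. ennreal (measure_pmf.prob p {\<omega>. restrict \<omega> A = x}))) {x}"
      using x by (subst emeasure_density) (auto simp: nn_integral_count_space_indicator[symmetric] nn_integral_indicator_singleton' )
    finally show "emeasure (distr (measure_pmf p) ?S (\<lambda>\<omega>. restrict \<omega> A)) {x} =
      emeasure (density ?S (\<lambda>x. ennreal (measure_pmf.prob p {\<omega>. restrict \<omega> A = x}))) {x}" .
  qed (use cnt in auto)
  then show ?thesis
    unfolding distributed_def by auto
qed

lemma restrict_eq_iff_ball: "restrict f A = restrict g A \<longleftrightarrow> (\<forall>e\<in>A. f e = g e)"
  by (auto simp: fun_eq_iff restrict_def)

text \<open>
  A density with respect to a counting measure on a countable space is unique, so every admissible \<open>f\<close> is the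
  mass function; the integrals of \<open>f log f\<close> then transport to the sample space.
\<close>

lemma entropy_of_tuple:
  fixes p :: "('a \<Rightarrow> nat) pmf"
  assumes A: "finite A"
  defines "S \<equiv> count_space (A \<rightarrow>\<^sub>E (UNIV :: nat set))" and "X \<equiv> (\<lambda>\<omega>. restrict \<omega> A)"
  shows "(\<exists>f. information_space.finite_entropy (measure_pmf p) 2 S X f) \<longleftrightarrow>
           integrable (measure_pmf p) (\<lambda>v. - ln (measure_pmf.prob p {w. \<forall>e\<in>A. w e = v e}))" (is ?A)
    and "prob_space.entropy (measure_pmf p) 2 S X = joint_entropy p (\<lambda>e \<omega>. \<omega> e) A / ln 2" (is ?B)
proof -
  interpret information_space "measure_pmf p" 2 by standard auto
  define q :: "('a \<Rightarrow> nat) \<Rightarrow> real" where "q = (\<lambda>x. measure_pmf.prob p {\<omega>. restrict \<omega> A = x})"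
  have D: "distributed (measure_pmf p) S X (\<lambda>x. ennreal (q x))"
    unfolding S_def X_def q_def by (rule distributed_pmf_tuple[OF A])
  have q0: "0 \<le> q x" for x by (simp add: q_def)
  have qX: "q (X v) = measure_pmf.prob p {w. \<forall>e\<in>A. w e = v e}" for v
    by (simp add: q_def X_def restrict_eq_iff_ball)
  \<comment> \<open>Evaluate both densities on a singleton.\<close>
  have uniq: "f x = q x" if "distributed (measure_pmf p) S X f" "x \<in> space S" "\<And>x. x \<in> space S \<Longrightarrow> 0 \<le> f x"
    for f :: "('a \<Rightarrow> nat) \<Rightarrow> real" and x
  proof -
    have "density S f = density S q"
      using that D unfolding distributed_def by metis
    then have "emeasure (density S f) {x} = emeasure (density S q) {x}" by simp
    then have "ennreal (f x) = ennreal (q x)"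
      using that(2) unfolding S_def
      by (auto simp: emeasure_density nn_integral_count_space_indicator[symmetric] nn_integral_indicator_singleton')
    then show ?thesis using that q0 by auto
  qed
  have meas: "(\<lambda>x. log 2 (q x)) \<in> borel_measurable S"
    by (simp add: S_def)
  have int: "integrable S (\<lambda>x. q x * log 2 (q x)) \<longleftrightarrow> integrable (measure_pmf p) (\<lambda>v. log 2 (q (X v)))"
    by (rule distributed_integrable[OF D meas]) (simp add: q0)
  have "integrable (measure_pmf p) (\<lambda>v. log 2 (q (X v))) \<longleftrightarrow> 
        integrable (measure_pmf p) (\<lambda>v. - ln (q (X v)))"
    unfolding log_def divide_inverse integrable_mult_right_iff by simp
  with int have int': "integrable S (\<lambda>x. q x * log 2 (q x)) \<longleftrightarrow>
     integrable (measure_pmf p) (\<lambda>v. - ln (q (X v)))" by simp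
  have "(\<exists>f. finite_entropy S X f) \<longleftrightarrow> finite_entropy S X q"
  proof
    assume "\<exists>f. finite_entropy S X f"
    then obtain f where f: "finite_entropy S X f" ..
    then have eq: "f x = q x" if "x \<in> space S" for x
      using uniq[of f x] that unfolding finite_entropy_def by auto
    have "integrable S (\<lambda>x. f x * log 2 (f x))" using f by (auto simp: finite_entropy_def)
    then have "integrable S (\<lambda>x. q x * log 2 (q x))"
      by (subst Bochner_Integration.integrable_cong[OF refl]) (auto simp: eq)
    then show "finite_entropy S X q" using D q0 by (auto simp: finite_entropy_def)
  qed auto
  also have "\<dots> \<longleftrightarrow> integrable S (\<lambda>x. q x * log 2 (q x))"
    using D q0 by (auto simp: finite_entropy_def)
  finally show ?A using int' by (simp add: qX)
  have "prob_space.entropy (measure_pmf p) 2 S X = - (\<integral>x. q x * log 2 (q x) \<partial>S)"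
    by (rule entropy_distr[OF D]) (simp add: q0)
  also have "(\<integral>x. q x * log 2 (q x) \<partial>S) = (\<integral>v. log 2 (q (X v)) \<partial>measure_pmf p)"
    by (rule distributed_integral[OF D meas]) (simp add: q0)
  also have "- (\<integral>v. log 2 (q (X v)) \<partial>measure_pmf p) = joint_entropy p (\<lambda>e \<omega>. \<omega> e) A / ln 2"
    by (simp add: joint_entropy_def qX log_def)
  finally show ?B .
qed

lemma joint_entropy_map_pmf:
  "joint_entropy (map_pmf f p) X A = joint_entropy p (\<lambda>e v. X e (f v)) A"
  by (simp add: joint_entropy_def vimage_def)

lemma entropic_finite_support:
  fixes p :: "'w pmf" and X :: "'a \<Rightarrow> 'w \<Rightarrow> nat"
  assumes E: "finite E" and fin: "finite (set_pmf p)"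
  shows "entropic E (\<lambda>A\<in>Pow E. joint_entropy p X A / ln 2)"
  unfolding entropic_def
proof (intro conjI exI[of _ "map_pmf (\<lambda>v e. X e v) p"] ballI)
  let ?p = "map_pmf (\<lambda>v e. X e v) p"
  fix A assume "A \<in> Pow E"
  then have A: "finite A" "A \<subseteq> E" using E finite_subset by auto
  have "integrable (measure_pmf ?p) (\<lambda>v. - ln (measure_pmf.prob ?p {w. \<forall>e\<in>A. w e = v e}))"
    by (rule integrable_measure_pmf_finite) (simp add: fin)
  then show "let S = count_space (A \<rightarrow>\<^sub>E (UNIV :: nat set)); X' = \<lambda>\<omega>. restrict \<omega> A
        in (\<exists>f. information_space.finite_entropy (measure_pmf ?p) 2 S X' f) \<and>
           (\<lambda>A\<in>Pow E. joint_entropy p X A / ln 2) A = prob_space.entropy (measure_pmf ?p) 2 S X'"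
    using A by (simp add: Let_def entropy_of_tuple joint_entropy_map_pmf)
qed auto

lemma entropic_imp_joint_entropy:
  fixes h :: "'a set \<Rightarrow> real"
  assumes E: "finite E" and h: "entropic E h"
  obtains p :: "('a \<Rightarrow> nat) pmf" where
    "\<And>A. A \<subseteq> E \<Longrightarrow> integrable (measure_pmf p) (\<lambda>v. - ln (measure_pmf.prob p {w. \<forall>e\<in>A. w e = v e}))"
    "\<And>A. A \<subseteq> E \<Longrightarrow> h A = joint_entropy p (\<lambda>e \<omega>. \<omega> e) A / ln 2"
proof -
  from h obtain p :: "('a \<Rightarrow> nat) pmf" where p: "\<forall>A\<in>Pow E.
        let S = count_space (A \<rightarrow>\<^sub>E (UNIV :: nat set)); X = (\<lambda>\<omega>. restrict \<omega> A)
        in (\<exists>f. information_space.finite_entropy (measure_pmf p) 2 S X f) \<and>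
           h A = prob_space.entropy (measure_pmf p) 2 S X"
    unfolding entropic_def by blast
  show ?thesis
  proof (rule that[of p])
    fix A assume A: "A \<subseteq> E"
    then have fA: "finite A" using E finite_subset by auto
    show "integrable (measure_pmf p) (\<lambda>v. - ln (measure_pmf.prob p {w. \<forall>e\<in>A. w e = v e}))"
      using p A entropy_of_tuple(1)[OF fA, of p] by (auto simp: Let_def)
    show "h A = joint_entropy p (\<lambda>e \<omega>. \<omega> e) A / ln 2"
      using p A entropy_of_tuple(2)[OF fA, of p] by (auto simp: Let_def)
  qed
qed

text \<open>
  Capping the values at \<open>m\<close> only enlarges classes, so the integrand is dominated by the uncapped one; and
  the class of a fixed outcome no longer changes once \<open>m\<close> exceeds its finitely many coordinates in \<open>A\<close>.
\<close>

lemma joint_entropy_capped_tendsto: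
  fixes p :: "('a \<Rightarrow> nat) pmf"
  assumes A: "finite A"
    and int: "integrable (measure_pmf p) (\<lambda>v. - ln (measure_pmf.prob p {w. \<forall>e\<in>A. w e = v e}))"
  shows "(\<lambda>m. joint_entropy p (\<lambda>e \<omega>. min (\<omega> e) m) A) \<longlonglongrightarrow> joint_entropy p (\<lambda>e \<omega>. \<omega> e) A"
  unfolding joint_entropy_def
proof (rule integral_dominated_convergence[OF _ _ int])
  show "AE v in measure_pmf p. (\<lambda>m. - ln (measure_pmf.prob p {w. \<forall>e\<in>A. min (w e) m = min (v e) m}))
          \<longlonglongrightarrow> - ln (measure_pmf.prob p {w. \<forall>e\<in>A. w e = v e})"
  proof (rule AE_I2)
    fix v
    define M where "M = Suc (\<Sum>e\<in>A. v e)"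
    have M: "v e < M" if "e \<in> A" for e
      using member_le_sum[of e A v] that A by (simp add: M_def)
    have "{w. \<forall>e\<in>A. min (w e) m = min (v e) m} = {w. \<forall>e\<in>A. w e = v e}" if "m \<ge> M" for m
      using M that by (fastforce simp: min_def split: if_splits)
    then show "(\<lambda>m. - ln (measure_pmf.prob p {w. \<forall>e\<in>A. min (w e) m = min (v e) m}))
          \<longlonglongrightarrow> - ln (measure_pmf.prob p {w. \<forall>e\<in>A. w e = v e})"
      by (intro tendsto_eventually eventually_sequentiallyI[of M]) simp
  qed
  show "AE v in measure_pmf p. norm (- ln (measure_pmf.prob p {w. \<forall>e\<in>A. min (w e) m = min (v e) m}))
          \<le> - ln (measure_pmf.prob p {w. \<forall>e\<in>A. w e = v e})" for m
  proof (rule AE_pmfI)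
    fix v assume v: "v \<in> set_pmf p"
    have "0 < pmf p v" using v by (simp add: pmf_positive)
    also have "pmf p v \<le> measure_pmf.prob p {w. \<forall>e\<in>A. w e = v e}"
      unfolding measure_pmf_single[symmetric] by (intro measure_pmf.finite_measure_mono) auto
    finally have 1: "0 < measure_pmf.prob p {w. \<forall>e\<in>A. w e = v e}" .
    have 2: "measure_pmf.prob p {w. \<forall>e\<in>A. w e = v e} \<le>
          measure_pmf.prob p {w. \<forall>e\<in>A. min (w e) m = min (v e) m}"
      by (intro measure_pmf.finite_measure_mono) auto
    then have "ln (measure_pmf.prob p {w. \<forall>e\<in>A. w e = v e}) \<le>
          ln (measure_pmf.prob p {w. \<forall>e\<in>A. min (w e) m = min (v e) m})" using 1 by simp
    moreover have "ln (measure_pmf.prob p {w. \<forall>e\<in>A. min (w e) m = min (v e) m}) \<le> 0"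
      using 1 2 by (subst ln_le_zero_iff) auto
    ultimately show "norm (- ln (measure_pmf.prob p {w. \<forall>e\<in>A. min (w e) m = min (v e) m}))
          \<le> - ln (measure_pmf.prob p {w. \<forall>e\<in>A. w e = v e})" by simp
  qed
qed auto

text \<open>
  As \<open>Pow E\<close> is finite, the product topology is that of uniform approximation; this lemma and the next are the
  two directions.
\<close>

lemma almost_entropic_cone_approx:
  assumes E: "finite E" and h: "h \<in> almost_entropic_cone E" and \<epsilon>: "0 < (\<epsilon> :: real)"
  obtains g where "g \<in> entropic_conic_hull E" "\<And>A. A \<subseteq> E \<Longrightarrow> \<bar>h A - g A\<bar> < \<epsilon>"
proof -
  let ?T = "PiE (Pow E) (\<lambda>A. ball (h A) \<epsilon>)"
  have "openin (powertop_real (Pow E)) ?T"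
    using E by (subst openin_PiE) auto
  moreover have "h \<in> ?T"
    using h \<epsilon> by (auto simp: almost_entropic_cone_def in_closure_of PiE_iff)
  ultimately obtain g where "g \<in> entropic_conic_hull E" "g \<in> ?T"
    using h unfolding almost_entropic_cone_def in_closure_of by blast
  then show ?thesis by (intro that[of g]) (auto simp: PiE_iff dist_real_def)
qed

lemma almost_entropic_coneI:
  assumes E: "finite E" and ext: "h \<in> extensional (Pow E)"
    and ap: "\<And>\<epsilon> :: real. 0 < \<epsilon> \<Longrightarrow> \<exists>g \<in> entropic_conic_hull E. \<forall>A\<subseteq>E. \<bar>h A - g A\<bar> < \<epsilon>"
  shows "h \<in> almost_entropic_cone E"
  unfolding almost_entropic_cone_def in_closure_of
proof (intro conjI allI impI)
  show "h \<in> topspace (powertop_real (Pow E))" using ext by (auto simp: PiE_iff)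
  fix T assume T: "h \<in> T \<and> openin (powertop_real (Pow E)) T"
  then obtain U where U: "\<And>A. A \<in> Pow E \<Longrightarrow> open (U A)" "h \<in> PiE (Pow E) U" "PiE (Pow E) U \<subseteq> T"
    unfolding openin_product_topology_alt by (metis open_openin)
  have "\<exists>\<delta>>0. ball (h A) \<delta> \<subseteq> U A" if "A \<in> Pow E" for A
    using U(1)[OF that] U(2) that by (meson PiE_mem openE)
  then obtain \<delta> where \<delta>: "\<And>A. A \<in> Pow E \<Longrightarrow> \<delta> A > 0 \<and> ball (h A) (\<delta> A) \<subseteq> U A" by metis
  define \<epsilon> where "\<epsilon> = Min (\<delta> ` Pow E)"
  have "\<epsilon> > 0" unfolding \<epsilon>_def using \<delta> E by (subst Min_gr_iff) (auto simp: Pow_not_empty)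
  have le: "\<epsilon> \<le> \<delta> A" if "A \<in> Pow E" for A using that E by (auto simp: \<epsilon>_def)
  from ap[OF \<open>\<epsilon> > 0\<close>] obtain g where g: "g \<in> entropic_conic_hull E" "\<forall>A\<subseteq>E. \<bar>h A - g A\<bar> < \<epsilon>" by blast
  have "g \<in> extensional (Pow E)" using g(1) by (auto simp: entropic_conic_hull_def)
  moreover have "g A \<in> U A" if "A \<in> Pow E" for A
  proof -
    have "g A \<in> ball (h A) (\<delta> A)" using g(2) le[OF that] that by (auto simp: dist_real_def dest!: spec[of _ A])
    then show ?thesis using \<delta>[OF that] by auto
  qed
  ultimately have "g \<in> PiE (Pow E) U" by (auto simp: PiE_iff)
  then show "\<exists>y. y \<in> entropic_conic_hull E \<and> y \<in> T" using U(3) g(1) by blast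
qed

section \<open>Quasi-uniform functions and their limits\<close>

definition cell :: "('a \<Rightarrow> 'w \<Rightarrow> nat) \<Rightarrow> 'w set \<Rightarrow> 'a set \<Rightarrow> 'w \<Rightarrow> 'w set" where
  "cell X V A v = {w \<in> V. \<forall>e\<in>A. X e w = X e v}"

text \<open>
  The entropy functions of uniform distributions all of whose classes are equally large, for each \<open>A\<close>
  separately. Given the values on \<open>A\<close>, the variables indexed by another set \<open>L\<close> are then uniformly
  distributed over a number of values that is the same for all conditions, so that collisions of a random hash of
  these values can be counted. The sample space is a set of natural numbers because its type has to be fixed under the
  existential quantifier; lemma \<open>quasi_uniformI\<close> allows any finite sample space.
\<close>

definition quasi_uniform :: "'a set \<Rightarrow> ('a set \<Rightarrow> real) \<Rightarrow> bool" where
  "quasi_uniform E q \<longleftrightarrow> (\<exists>(V :: nat set) X. finite V \<and> V \<noteq> {} \<and>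
     (\<forall>A\<subseteq>E. \<forall>v\<in>V. q A = ln (real (card V)) - ln (real (card (cell X V A v)))))"

lemma cell_subset: "cell X V A v \<subseteq> V"
  by (auto simp: cell_def)

lemma card_cell_pos: "finite V \<Longrightarrow> v \<in> V \<Longrightarrow> 0 < card (cell X V A v)"
  by (auto simp: card_gt_0_iff cell_def)

lemma quasi_uniformI:
  fixes V :: "'w set" and X :: "'a \<Rightarrow> 'w \<Rightarrow> nat"
  assumes V: "finite V" "V \<noteq> {}"
    and q: "\<And>A v. A \<subseteq> E \<Longrightarrow> v \<in> V \<Longrightarrow> q A = ln (real (card V)) - ln (real (card (cell X V A v)))"
  shows "quasi_uniform E q"
proof -
  obtain f where f: "bij_betw f V {..<card V}"
    using V(1) by (metis atLeast0LessThan ex_bij_betw_finite_nat)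
  define g where "g = inv_into V f"
  define Y where "Y = (\<lambda>e i. X e (g i))"
  have inj: "inj_on f V" using f by (simp add: bij_betw_def)
  have gf: "g (f v) = v" if "v \<in> V" for v
    unfolding g_def using inj that by (rule inv_into_f_f)
  have cell_eq: "cell Y (f ` V) A (f v) = f ` cell X V A v" if "v \<in> V" for A v
    using that by (auto simp: cell_def Y_def gf)
  have "card (cell Y (f ` V) A (f v)) = card (cell X V A v)" if "v \<in> V" for A v
    unfolding cell_eq[OF that] by (rule card_image[OF inj_on_subset[OF inj cell_subset]])
  moreover have "card (f ` V) = card V" by (rule card_image[OF inj])
  ultimately have "\<forall>A\<subseteq>E. \<forall>v\<in>f ` V. q A = ln (real (card (f ` V))) - ln (real (card (cell Y (f ` V) A v)))"
    using q by simp
  moreover have "finite (f ` V)" "f ` V \<noteq> {}" using V by auto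
  ultimately show ?thesis
    unfolding quasi_uniform_def by blast
qed

text \<open>
  Take the two families independently and pair their values.
\<close>

lemma quasi_uniform_add:
  assumes "quasi_uniform E q\<^sub>1" "quasi_uniform E q\<^sub>2"
  shows "quasi_uniform E (\<lambda>A. q\<^sub>1 A + q\<^sub>2 A)"
proof -
  obtain V X where 1: "finite V" "V \<noteq> {}"
     "\<forall>A\<subseteq>E. \<forall>v\<in>V. q\<^sub>1 A = ln (real (card V)) - ln (real (card (cell X V A (v::nat))))"
    using assms(1) unfolding quasi_uniform_def by blast
  obtain W Y where 2: "finite W" "W \<noteq> {}"
     "\<forall>A\<subseteq>E. \<forall>v\<in>W. q\<^sub>2 A = ln (real (card W)) - ln (real (card (cell Y W A (v::nat))))"
    using assms(2) unfolding quasi_uniform_def by blast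
  define Z where "Z = (\<lambda>e u. prod_encode (X e (fst u), Y e (snd u)))"
  have cell_eq: "cell Z (V \<times> W) A u = cell X V A (fst u) \<times> cell Y W A (snd u)" for A u
    by (auto simp: cell_def Z_def)
  show ?thesis
  proof (rule quasi_uniformI[of "V \<times> W" _ _ Z])
    fix A u assume A: "A \<subseteq> E" and u: "u \<in> V \<times> W"
    then have u': "fst u \<in> V" "snd u \<in> W" by auto
    have "0 < card (cell X V A (fst u))" "0 < card (cell Y W A (snd u))" "0 < card V" "0 < card W"
      using card_cell_pos[OF 1(1) u'(1)] card_cell_pos[OF 2(1) u'(2)] 1(1,2) 2(1,2)
      by (simp_all add: card_gt_0_iff[of V] card_gt_0_iff[of W])
    then show "q\<^sub>1 A + q\<^sub>2 A = ln (real (card (V \<times> W))) - ln (real (card (cell Z (V \<times> W) A u)))"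
      using 1(3)[rule_format, OF A, of "fst u"] 2(3)[rule_format, OF A, of "snd u"] u
      unfolding cell_eq card_cartesian_product of_nat_mult by (simp add: ln_mult mem_Times_iff)
  qed (use 1(1,2) 2(1,2) in auto)
qed

lemma quasi_uniform_zero: "quasi_uniform E (\<lambda>A. 0)"
  by (rule quasi_uniformI[of "{()}" _ _ "\<lambda>_ _. 0"]) (auto simp: cell_def)

text \<open>
  The new variables are constant.
\<close>

lemma quasi_uniform_extend:
  assumes "quasi_uniform F q"
  shows "quasi_uniform E (\<lambda>A. q (A \<inter> F))"
proof -
  obtain V X where 1: "finite V" "V \<noteq> {}"
     "\<forall>A\<subseteq>F. \<forall>v\<in>V. q A = ln (real (card V)) - ln (real (card (cell X V A (v::nat))))"
    using assms(1) unfolding quasi_uniform_def by blast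
  define Y where "Y = (\<lambda>e v. if e \<in> F then X e v else 0)"
  have cell_eq: "cell Y V A = cell X V (A \<inter> F)" for A by (auto simp: cell_def Y_def fun_eq_iff)
  show ?thesis
    by (rule quasi_uniformI[OF 1(1,2), of _ _ Y]) (use 1(3) cell_eq in simp)
qed

text \<open>
  The scale is \<open>N\<close> itself, and every large \<open>N\<close> must occur, so that approximations of two functions can be
  added without first finding a common scale.
\<close>

definition quasi_uniform_limit :: "'a set \<Rightarrow> ('a set \<Rightarrow> real) \<Rightarrow> bool" where
  "quasi_uniform_limit E h \<longleftrightarrow> (\<forall>\<epsilon>>0. \<forall>\<^sub>F N in sequentially.
     \<exists>q. quasi_uniform E q \<and> (\<forall>A\<subseteq>E. \<bar>real N * h A - q A\<bar> \<le> \<epsilon> * real N))"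

lemma quasi_uniform_limit_cong:
  assumes "quasi_uniform_limit E h" "\<And>A. A \<subseteq> E \<Longrightarrow> h A = h' A"
  shows "quasi_uniform_limit E h'"
  using assms unfolding quasi_uniform_limit_def by simp

lemma quasi_uniform_limit_add:
  assumes "quasi_uniform_limit E h\<^sub>1" "quasi_uniform_limit E h\<^sub>2"
  shows "quasi_uniform_limit E (\<lambda>A. h\<^sub>1 A + h\<^sub>2 A)"
  unfolding quasi_uniform_limit_def
proof (intro allI impI)
  fix \<epsilon> :: real assume "\<epsilon> > 0"
  then have "\<epsilon>/2 > 0" by simp
  then have "\<forall>\<^sub>F N in sequentially. \<exists>q. quasi_uniform E q \<and> (\<forall>A\<subseteq>E. \<bar>real N * h\<^sub>1 A - q A\<bar> \<le> \<epsilon>/2 * real N)"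
    "\<forall>\<^sub>F N in sequentially. \<exists>q. quasi_uniform E q \<and> (\<forall>A\<subseteq>E. \<bar>real N * h\<^sub>2 A - q A\<bar> \<le> \<epsilon>/2 * real N)"
    using assms unfolding quasi_uniform_limit_def by blast+
  then show "\<forall>\<^sub>F N in sequentially.
      \<exists>q. quasi_uniform E q \<and> (\<forall>A\<subseteq>E. \<bar>real N * (h\<^sub>1 A + h\<^sub>2 A) - q A\<bar> \<le> \<epsilon> * real N)"
  proof eventually_elim
    case (elim N)
    then obtain q\<^sub>1 q\<^sub>2 where q: "quasi_uniform E q\<^sub>1" "quasi_uniform E q\<^sub>2"
      "\<And>A. A \<subseteq> E \<Longrightarrow> \<bar>real N * h\<^sub>1 A - q\<^sub>1 A\<bar> \<le> \<epsilon>/2 * real N"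
      "\<And>A. A \<subseteq> E \<Longrightarrow> \<bar>real N * h\<^sub>2 A - q\<^sub>2 A\<bar> \<le> \<epsilon>/2 * real N" by blast
    have "\<bar>real N * (h\<^sub>1 A + h\<^sub>2 A) - (q\<^sub>1 A + q\<^sub>2 A)\<bar> \<le> \<epsilon> * real N" if "A \<subseteq> E" for A
      using q(3,4)[OF that] unfolding distrib_left by linarith
    then show ?case using quasi_uniform_add[OF q(1,2)] by blast
  qed
qed

lemma quasi_uniform_limit_zero: "quasi_uniform_limit E (\<lambda>A. 0)"
  unfolding quasi_uniform_limit_def
  using quasi_uniform_zero[of E] by (auto intro!: always_eventually exI[of _ "\<lambda>A. 0"])

text \<open>
  Approximate \<open>c h\<close> at scale \<open>N\<close> by what approximates \<open>h\<close> at scale \<open>\<lfloor>c N\<rfloor>\<close>.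
\<close>

lemma quasi_uniform_limit_scale:
  assumes E: "finite E" and h: "quasi_uniform_limit E h" and c: "0 \<le> (c :: real)"
  shows "quasi_uniform_limit E (\<lambda>A. c * h A)"
proof (cases "c = 0")
  case True
  then show ?thesis using quasi_uniform_limit_zero[of E] by simp
next
  case False
  with c have c: "c > 0" by simp
  show ?thesis unfolding quasi_uniform_limit_def
  proof (intro allI impI)
    fix \<epsilon> :: real assume \<epsilon>: "\<epsilon> > 0"
    define B where "B = (\<Sum>A\<in>Pow E. \<bar>h A\<bar>)"
    have B: "\<bar>h A\<bar> \<le> B" if "A \<subseteq> E" for A
      unfolding B_def using E that by (intro member_le_sum) auto
    define \<delta> where "\<delta> = \<epsilon> / (2 * c)"
    have \<delta>: "\<delta> > 0" using \<epsilon> c by (simp add: \<delta>_def)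
    define m where "m = (\<lambda>N::nat. nat \<lfloor>c * real N\<rfloor>)"
    have m: "real (m N) \<le> c * real N" "c * real N < real (m N) + 1" for N
      using c by (auto simp: m_def of_nat_nat)
    have "filterlim m at_top sequentially"
      unfolding m_def
      by (rule filterlim_compose[OF filterlim_nat_sequentially],
          rule filterlim_compose[OF filterlim_floor_sequentially],
          rule filterlim_tendsto_pos_mult_at_top[OF tendsto_const c filterlim_real_sequentially])
    moreover have "\<forall>\<^sub>F N in sequentially.
        \<exists>q. quasi_uniform E q \<and> (\<forall>A\<subseteq>E. \<bar>real N * h A - q A\<bar> \<le> \<delta> * real N)"
      using h \<delta> unfolding quasi_uniform_limit_def by blast
    ultimately have "\<forall>\<^sub>F N in sequentially.
        \<exists>q. quasi_uniform E q \<and> (\<forall>A\<subseteq>E. \<bar>real (m N) * h A - q A\<bar> \<le> \<delta> * real (m N))"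
      by (auto simp: filterlim_iff)
    moreover have "\<forall>\<^sub>F N in sequentially. 2 * B / \<epsilon> \<le> real N"
      using filterlim_real_sequentially by (auto simp: filterlim_at_top)
    ultimately show "\<forall>\<^sub>F N in sequentially.
        \<exists>q. quasi_uniform E q \<and> (\<forall>A\<subseteq>E. \<bar>real N * (c * h A) - q A\<bar> \<le> \<epsilon> * real N)"
    proof eventually_elim
      case (elim N)
      then obtain q where q: "quasi_uniform E q"
        "\<And>A. A \<subseteq> E \<Longrightarrow> \<bar>real (m N) * h A - q A\<bar> \<le> \<delta> * real (m N)" by blast
      have "\<bar>real N * (c * h A) - q A\<bar> \<le> \<epsilon> * real N" if A: "A \<subseteq> E" for A
      proof -
        have "\<bar>real N * (c * h A) - real (m N) * h A\<bar> = \<bar>c * real N - real (m N)\<bar> * \<bar>h A\<bar>"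
          by (simp add: algebra_simps flip: abs_mult)
        also have "\<dots> \<le> 1 * B"
          using m[of N] B[OF A] by (intro mult_mono) auto
        also have "\<dots> \<le> \<epsilon> / 2 * real N"
          using elim(2) \<epsilon> by (simp add: field_simps)
        finally have 1: "\<bar>real N * (c * h A) - real (m N) * h A\<bar> \<le> \<epsilon> / 2 * real N" .
        have "\<delta> * real (m N) \<le> \<delta> * (c * real N)" using \<delta> m by (intro mult_left_mono) auto
        also have "\<dots> = \<epsilon> / 2 * real N" using c by (simp add: \<delta>_def)
        finally show ?thesis using q(2)[OF A] 1 by linarith
      qed
      then show ?case using q(1) by blast
    qed
  qed
qed

lemma quasi_uniform_limit_sum:
  fixes n :: nat
  assumes "finite E" "\<And>i. i < n \<Longrightarrow> 0 \<le> (c i :: real) \<and> quasi_uniform_limit E (g i)"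
  shows "quasi_uniform_limit E (\<lambda>A. \<Sum>i<n. c i * g i A)"
  using assms(2)
proof (induction n)
  case 0
  then show ?case using quasi_uniform_limit_zero by simp
next
  case (Suc n)
  then have "quasi_uniform_limit E (\<lambda>A. (\<Sum>i<n. c i * g i A) + c n * g n A)"
    by (intro quasi_uniform_limit_add quasi_uniform_limit_scale assms(1)) auto
  then show ?case by simp
qed

lemma quasi_uniform_limit_closed:
  assumes ap: "\<And>\<epsilon> :: real. 0 < \<epsilon> \<Longrightarrow> \<exists>g. quasi_uniform_limit E g \<and> (\<forall>A\<subseteq>E. \<bar>h A - g A\<bar> \<le> \<epsilon>)"
  shows "quasi_uniform_limit E h"
  unfolding quasi_uniform_limit_def
proof (intro allI impI)
  fix \<epsilon> :: real assume "\<epsilon> > 0"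
  then have \<epsilon>: "\<epsilon>/2 > 0" by simp
  then obtain g where g: "quasi_uniform_limit E g" "\<forall>A\<subseteq>E. \<bar>h A - g A\<bar> \<le> \<epsilon>/2"
    using ap by blast
  from g(1) \<epsilon> have "\<forall>\<^sub>F N in sequentially. \<exists>q. quasi_uniform E q \<and> (\<forall>A\<subseteq>E. \<bar>real N * g A - q A\<bar> \<le> \<epsilon>/2 * real N)"
    unfolding quasi_uniform_limit_def by blast
  then show "\<forall>\<^sub>F N in sequentially.
      \<exists>q. quasi_uniform E q \<and> (\<forall>A\<subseteq>E. \<bar>real N * h A - q A\<bar> \<le> \<epsilon> * real N)"
  proof eventually_elim
    case (elim N)
    then obtain q where q: "quasi_uniform E q"
      "\<And>A. A \<subseteq> E \<Longrightarrow> \<bar>real N * g A - q A\<bar> \<le> \<epsilon>/2 * real N" by blast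
    have "\<bar>real N * h A - q A\<bar> \<le> \<epsilon> * real N" if A: "A \<subseteq> E" for A
    proof -
      have "\<bar>real N * h A - real N * g A\<bar> = real N * \<bar>h A - g A\<bar>"
        by (simp add: right_diff_distrib[symmetric] abs_mult)
      also have "\<dots> \<le> real N * (\<epsilon>/2)" using g(2) A by (intro mult_left_mono) auto
      also have "\<dots> = \<epsilon>/2 * real N" by simp
      finally show ?thesis using q(2)[OF A] by linarith
    qed
    then show ?case using q(1) by blast
  qed
qed

lemma quasi_uniform_limit_extend:
  assumes "quasi_uniform_limit F h"
  shows "quasi_uniform_limit E (\<lambda>A. h (A \<inter> F))"
  unfolding quasi_uniform_limit_def
proof (intro allI impI)
  fix \<epsilon> :: real assume "\<epsilon> > 0"
  with assms have "\<forall>\<^sub>F N in sequentially. \<exists>q. quasi_uniform F q \<and> (\<forall>A\<subseteq>F. \<bar>real N * h A - q A\<bar> \<le> \<epsilon> * real N)"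
    unfolding quasi_uniform_limit_def by blast
  then show "\<forall>\<^sub>F N in sequentially.
      \<exists>q. quasi_uniform E q \<and> (\<forall>A\<subseteq>E. \<bar>real N * h (A \<inter> F) - q A\<bar> \<le> \<epsilon> * real N)"
  proof eventually_elim
    case (elim N)
    then obtain q where q: "quasi_uniform F q" "\<forall>A\<subseteq>F. \<bar>real N * h A - q A\<bar> \<le> \<epsilon> * real N" by blast
    show ?case
      using quasi_uniform_extend[OF q(1), of E] q(2) by (intro exI[of _ "\<lambda>A. q (A \<inter> F)"]) auto
  qed
qed

section \<open>Almost entropic functions are limits of quasi-uniform ones\<close>

lemma ln_fact_bounds:
  "real (Suc n) * ln (real (Suc n)) - real (Suc n) \<le> ln (fact (Suc n)) \<and>
   ln (fact (Suc n)) \<le> real (Suc n) * ln (real (Suc n)) - real (Suc n) + 1 + ln (real (Suc n))"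
proof (induction n)
  case 0
  show ?case by simp
next
  case (Suc n)
  let ?a = "real (Suc n)" and ?b = "real (Suc (Suc n))"
  have pos: "?a > 0" "?b > 0" by simp_all
  have "ln (?b / ?a) \<le> ?b / ?a - 1" using pos by (intro ln_le_minus_one) simp
  then have "?a * (ln ?b - ln ?a) \<le> ?a * (?b / ?a - 1)"
    using pos by (simp only: ln_div) (simp add: mult_left_mono)
  also have "?a * (?b / ?a - 1) = 1" by (simp add: field_simps)
  finally have 1: "?a * ln ?b - ?a * ln ?a \<le> 1" by (simp only: right_diff_distrib)
  have "ln (?a / ?b) \<le> ?a / ?b - 1" using pos by (intro ln_le_minus_one) simp
  then have "?b * (ln ?a - ln ?b) \<le> ?b * (?a / ?b - 1)"
    using pos by (simp only: ln_div) (simp add: mult_left_mono)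
  also have "?b * (?a / ?b - 1) = -1" by (simp add: field_simps)
  finally have 2: "?b * ln ?a - ?b * ln ?b \<le> -1" by (simp only: right_diff_distrib)
  have f: "ln (fact (Suc (Suc n)) :: real) = ln ?b + ln (fact (Suc n))"
    by (subst fact_Suc) (simp only: ln_mult_pos of_nat_0_less_iff zero_less_Suc fact_gt_zero)
  have b: "?b = ?a + 1" by simp
  have e1: "?b * ln ?b = ?a * ln ?b + ln ?b" and e2: "?b * ln ?a = ?a * ln ?a + ln ?a"
    unfolding b by (simp_all only: distrib_right mult_1)
  show ?case unfolding f using Suc 1 2 e1 e2 b by linarith
qed

text \<open>
  In a multinomial coefficient the terms \<open>k ln N\<close> and \<open>k\<close> cancel, because the \<open>k\<close> sum to the total; what
  remains of \<open>ln k! / N\<close> is \<open>a ln a\<close>, the summand of an entropy.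
\<close>

lemma stirling_limit:
  fixes k :: "nat \<Rightarrow> nat" and a :: real
  assumes a: "a > 0" and k: "(\<lambda>N. real (k N) / real N) \<longlonglongrightarrow> a"
  shows "(\<lambda>N. (ln (fact (k N)) - real (k N) * ln (real N) + real (k N)) / real N) \<longlonglongrightarrow> a * ln a"
proof -
  define d where "d = (\<lambda>N. ln (fact (k N)) - (real (k N) * ln (real (k N)) - real (k N)))"
  have ev: "\<forall>\<^sub>F N in sequentially. 0 < real (k N) / real N \<and> real (k N) / real N < a + 1"
    using order_tendstoD[OF k] a by (auto intro: eventually_conj)
  have d0: "(\<lambda>N. d N / real N) \<longlonglongrightarrow> 0"
  proof (rule tendsto_sandwich[of "\<lambda>_. 0" _ _ "\<lambda>N. (1 + ln (a + 1)) / real N + ln (real N) / real N"])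
    show "\<forall>\<^sub>F N in sequentially. 0 \<le> d N / real N"
      using ev
    proof eventually_elim
      case (elim N)
      then have "k N \<noteq> 0" by (auto simp: zero_less_divide_iff)
      then obtain n where "k N = Suc n" using not0_implies_Suc by blast
      then show ?case using ln_fact_bounds[of n] by (simp add: d_def)
    qed
    show "\<forall>\<^sub>F N in sequentially. d N / real N \<le> (1 + ln (a + 1)) / real N + ln (real N) / real N"
      using ev
    proof eventually_elim
      case (elim N)
      then have kN: "k N \<noteq> 0" and N: "N \<noteq> 0" by (auto intro: ccontr)
      then obtain n where n: "k N = Suc n" using not0_implies_Suc by blast
      have "real (k N) \<le> (a + 1) * real N" using elim N by (simp add: divide_less_eq)
      then have "ln (real (k N)) \<le> ln ((a + 1) * real N)" using kN by simp
      also have "\<dots> = ln (a + 1) + ln (real N)" using a N by (simp add: ln_mult)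
      finally have "d N \<le> (1 + ln (a + 1)) + ln (real N)"
        using ln_fact_bounds[of n, folded n] unfolding d_def by linarith
      then show ?case using N by (simp add: divide_right_mono flip: add_divide_distrib)
    qed
    show "(\<lambda>N. (1 + ln (a + 1)) / real N + ln (real N) / real N) \<longlonglongrightarrow> 0"
      using tendsto_add[OF lim_const_over_n[of "1 + ln (a + 1)"] lim_ln_over_n] by simp
  qed auto
  have "(\<lambda>N. (real (k N) / real N) * ln (real (k N) / real N) + d N / real N) \<longlonglongrightarrow> a * ln a + 0"
    using a by (intro tendsto_intros k d0) auto
  moreover have "\<forall>\<^sub>F N in sequentially.
      (real (k N) / real N) * ln (real (k N) / real N) + d N / real N =
      (ln (fact (k N)) - real (k N) * ln (real N) + real (k N)) / real N"
    using ev
  proof eventually_elim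
    case (elim N)
    then have kN: "k N \<noteq> 0" and N: "N \<noteq> 0" by (auto intro: ccontr)
    then show ?case by (simp add: d_def ln_div field_simps)
  qed
  ultimately have "(\<lambda>N. (ln (fact (k N)) - real (k N) * ln (real N) + real (k N)) / real N)
      \<longlonglongrightarrow> a * ln a + 0"
    by (rule Lim_transform_eventually)
  then show ?thesis by simp
qed

lemma card_eq_card_image_times:
  assumes V: "finite V" and c: "\<And>v. v \<in> V \<Longrightarrow> card {w \<in> V. f w = f v} = c"
  shows "card V = card (f ` V) * c"
proof -
  have "card V = (\<Sum>v\<in>V. 1)" by simp
  also have "\<dots> = (\<Sum>y\<in>f ` V. \<Sum>v\<in>{w \<in> V. f w = y}. 1)"
    by (rule sum.image_gen[OF V])
  also have "\<dots> = (\<Sum>y\<in>f ` V. c)"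
    using c by (intro sum.cong) auto
  finally show ?thesis by simp
qed

text \<open>
  A permutation of positions carrying \<open>w\<close> to \<open>w'\<close> acts on all arrangements and maps the arrangements that
  agree with \<open>w\<close> after \<open>f\<close> to those that agree with \<open>w'\<close>. By symmetry the two numbers are equal.
\<close>

lemma card_same_image_permutations:
  assumes "w \<in> permutations_of_multiset M" "w' \<in> permutations_of_multiset M"
  shows "card {u \<in> permutations_of_multiset M. map f u = map f w} \<le>
         card {u \<in> permutations_of_multiset M. map f u = map f w'}"
proof -
  have "mset w' = mset w" using assms by (simp add: permutations_of_multiset_def)
  then obtain \<sigma> where \<sigma>: "\<sigma> permutes {..<length w}" "permute_list \<sigma> w = w'"
    by (rule mset_eq_permutation)
  have len: "length u = length w" if "u \<in> permutations_of_multiset M" for u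
    using that assms by (simp add: length_finite_permutations_of_multiset)
  show ?thesis
  proof (rule card_inj_on_le[of "permute_list \<sigma>"])
    show "inj_on (permute_list \<sigma>) {u \<in> permutations_of_multiset M. map f u = map f w}"
    proof (rule inj_onI, elim CollectE conjE)
      fix u v assume uv: "u \<in> permutations_of_multiset M" "v \<in> permutations_of_multiset M"
        and eq: "permute_list \<sigma> u = permute_list \<sigma> v"
      have "permute_list (inv \<sigma>) (permute_list \<sigma> x) = x" if "x \<in> permutations_of_multiset M" for x
        using permute_list_compose[of "inv \<sigma>" x \<sigma>] \<sigma>(1) len[OF that]
        by (simp add: permutes_inv permutes_inv_o)
      then show "u = v" using eq uv by metis
    qed
    show "permute_list \<sigma> ` {u \<in> permutations_of_multiset M. map f u = map f w} \<subseteq>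
          {u \<in> permutations_of_multiset M. map f u = map f w'}"
    proof (rule image_subsetI, elim CollectE conjE)
      fix u assume u: "u \<in> permutations_of_multiset M" "map f u = map f w"
      have "map f (permute_list \<sigma> u) = permute_list \<sigma> (map f u)"
        using \<sigma>(1) len[OF u(1)] by (simp add: permute_list_map)
      also have "\<dots> = map f (permute_list \<sigma> w)"
        using \<sigma>(1) u(2) by (simp add: permute_list_map)
      finally have "map f (permute_list \<sigma> u) = map f w'" using \<sigma>(2) by simp
      moreover have "mset (permute_list \<sigma> u) = mset u"
        using \<sigma>(1) len[OF u(1)] by (intro mset_permute_list) simp
      ultimately show "permute_list \<sigma> u \<in> {u \<in> permutations_of_multiset M. map f u = map f w'}"
        using u(1) by (simp add: permutations_of_multiset_def)
    qed
  qed simp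
qed

text \<open>
  A uniformly random arrangement of \<open>M\<close>, observed entrywise through the variables \<open>X e\<close> with \<open>e \<in> A\<close>, is
  uniformly distributed over the arrangements of the image of \<open>M\<close>.
\<close>

lemma quasi_uniform_permutations:
  fixes X :: "'a \<Rightarrow> 'w \<Rightarrow> nat" and M :: "'w multiset"
  shows "quasi_uniform E
    (\<lambda>A. ln (real (card (permutations_of_multiset (image_mset (\<lambda>v. restrict (\<lambda>e. X e v) A) M)))))"
proof -
  define V where "V = permutations_of_multiset M"
  \<comment> \<open>The variable of \<open>e\<close> is the whole list of observed values, coded as one number.\<close>
  define Y where "Y = (\<lambda>e w. to_nat (map (X e) w))"
  define key where "key = (\<lambda>A v. restrict (\<lambda>e. X e v) A)"
  have V: "finite V" "V \<noteq> {}" by (simp_all add: V_def)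
  have len: "length u = size M" if "u \<in> V" for u
    using that by (simp add: V_def length_finite_permutations_of_multiset)
  have cell_eq: "cell Y V A w = {u \<in> V. map (key A) u = map (key A) w}" if w: "w \<in> V" for A w
  proof -
    have "(\<forall>e\<in>A. Y e u = Y e w) \<longleftrightarrow> map (key A) u = map (key A) w" if u: "u \<in> V" for u
      using len[OF u] len[OF w]
      by (auto simp: Y_def key_def list_eq_iff_nth_eq restrict_eq_iff_ball)
    then show ?thesis by (auto simp: cell_def)
  qed
  show ?thesis
  proof (rule quasi_uniformI[OF V, of _ _ Y])
    fix A w assume w: "w \<in> V"
    have "card {u \<in> V. map (key A) u = map (key A) v} = card {u \<in> V. map (key A) u = map (key A) w}"
      if v: "v \<in> V" for v
      using v w unfolding V_def by (intro antisym card_same_image_permutations)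
    then have "card {u \<in> V. map (key A) u = map (key A) v} = card (cell Y V A w)" if v: "v \<in> V" for v
      using cell_eq[OF w] v by simp
    then have "card V = card (map (key A) ` V) * card (cell Y V A w)"
      by (rule card_eq_card_image_times[OF V(1)])
    moreover have "map (key A) ` V = permutations_of_multiset (image_mset (key A) M)"
      unfolding V_def by (rule permutations_of_multiset_image[symmetric])
    ultimately have "card V = card (permutations_of_multiset (image_mset (key A) M)) * card (cell Y V A w)"
      by simp
    moreover have "card (permutations_of_multiset (image_mset (key A) M)) > 0"
      by (simp add: card_gt_0_iff)
    moreover have "card (cell Y V A w) > 0" by (rule card_cell_pos[OF V(1) w])
    ultimately show "ln (real (card (permutations_of_multiset (image_mset (\<lambda>v. restrict (\<lambda>e. X e v) A) M))))
        = ln (real (card V)) - ln (real (card (cell Y V A w)))"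
      unfolding key_def by (simp add: ln_mult)
  qed
qed

lemma ln_card_permutations_of_multiset:
  "ln (real (card (permutations_of_multiset M))) =
   ln (fact (size M)) - (\<Sum>x\<in>set_mset M. ln (fact (count M x)))"
proof -
  have "real (card (permutations_of_multiset M)) * (\<Prod>x\<in>set_mset M. fact (count M x)) = fact (size M)"
    using arg_cong[OF card_permutations_of_multiset_aux[of M], of real] by simp
  then have "ln (fact (size M)) = ln (real (card (permutations_of_multiset M)) * (\<Prod>x\<in>set_mset M. fact (count M x)))"
    by simp
  also have "\<dots> = ln (real (card (permutations_of_multiset M))) + ln (\<Prod>x\<in>set_mset M. fact (count M x))"
    by (intro ln_mult_pos prod_pos) (simp_all add: card_gt_0_iff)
  also have "ln (\<Prod>x\<in>set_mset M. fact (count M x) :: real) = (\<Sum>x\<in>set_mset M. ln (fact (count M x)))"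
    by (rule ln_prod) simp_all
  finally show ?thesis by simp
qed

lemma joint_entropy_finite_support:
  fixes p :: "'w pmf" and X :: "'a \<Rightarrow> 'w \<Rightarrow> nat"
  assumes fin: "finite (set_pmf p)"
  defines "key \<equiv> \<lambda>A v. restrict (\<lambda>e. X e v) A"
  defines "P \<equiv> \<lambda>A x. \<Sum>v\<in>{v \<in> set_pmf p. key A v = x}. pmf p v"
  shows "joint_entropy p X A = - (\<Sum>x\<in>key A ` set_pmf p. P A x * ln (P A x))"
proof -
  have prob: "measure_pmf.prob p {w. \<forall>e\<in>A. X e w = X e v} = P A (key A v)" for v
  proof -
    have "measure_pmf.prob p {w. \<forall>e\<in>A. X e w = X e v} =
       measure_pmf.prob p {w \<in> set_pmf p. key A w = key A v}"
      by (subst measure_Int_set_pmf[symmetric])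
         (auto simp: key_def restrict_eq_iff_ball intro!: arg_cong[where f="measure_pmf.prob p"])
    also have "\<dots> = P A (key A v)"
      unfolding P_def using fin by (intro measure_measure_pmf_finite) simp
    finally show ?thesis .
  qed
  have "joint_entropy p X A = (\<Sum>v\<in>set_pmf p. - ln (P A (key A v)) * pmf p v)"
    unfolding joint_entropy_def prob by (rule integral_measure_pmf_real[OF fin]) auto
  also have "\<dots> = (\<Sum>x\<in>key A ` set_pmf p. \<Sum>v\<in>{v \<in> set_pmf p. key A v = x}. - ln (P A (key A v)) * pmf p v)"
    by (rule sum.image_gen[OF fin])
  also have "\<dots> = (\<Sum>x\<in>key A ` set_pmf p. - (P A x * ln (P A x)))"
    by (intro sum.cong) (auto simp: P_def sum_distrib_right[symmetric] sum_negf mult.commute)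
  finally show ?thesis by (simp add: sum_negf)
qed

text \<open>
  Take a multiset with about \<open>N p(v)\<close> copies of each \<open>v\<close>. The number of its arrangements, seen
  through any subset of the variables, is a multinomial coefficient whose logarithm is \<open>N\<close> times the entropy up to
  \<open>o(N)\<close>.
\<close>

lemma quasi_uniform_limit_finite_support:
  fixes p :: "'w pmf" and X :: "'a \<Rightarrow> 'w \<Rightarrow> nat"
  assumes E: "finite E" and fin: "finite (set_pmf p)"
  shows "quasi_uniform_limit E (joint_entropy p X)"
proof -
  define F where "F = set_pmf p"
  have F: "finite F" using fin by (simp add: F_def)
  define key where "key = (\<lambda>A v. restrict (\<lambda>e. X e v) A)"
  \<comment> \<open>The successor keeps every outcome of the support present.\<close>
  define k where "k = (\<lambda>N v. Suc (nat \<lfloor>real N * pmf p v\<rfloor>))"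
  define M where "M = (\<lambda>N. \<Sum>v\<in>F. replicate_mset (k N v) v)"
  define q where "q = (\<lambda>N A. ln (real (card (permutations_of_multiset (image_mset (key A) (M N))))))"
  define P where "P = (\<lambda>A x. \<Sum>v\<in>{v \<in> F. key A v = x}. pmf p v)"
  define K where "K = (\<lambda>N A x. \<Sum>v\<in>{v \<in> F. key A v = x}. k N v)"
  define S where "S = (\<lambda>(m::nat) N. (ln (fact m) - real m * ln (real N) + real m) / real N)"
  have k_lim: "(\<lambda>N. real (k N v) / real N) \<longlonglongrightarrow> pmf p v" for v
  proof (rule tendsto_sandwich[of "\<lambda>_. pmf p v" _ _ "\<lambda>N. pmf p v + 1 / real N"])
    have b: "real N * pmf p v \<le> real (k N v)" "real (k N v) \<le> real N * pmf p v + 1" for N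
      unfolding k_def using pmf_nonneg[of p v] by (simp_all add: of_nat_nat) linarith+
    show "\<forall>\<^sub>F N in sequentially. pmf p v \<le> real (k N v) / real N"
      using eventually_gt_at_top[of 0]
    proof eventually_elim
      case (elim N)
      then show ?case using b[of N] by (simp add: field_simps)
    qed
    show "\<forall>\<^sub>F N in sequentially. real (k N v) / real N \<le> pmf p v + 1 / real N"
      using eventually_gt_at_top[of 0]
    proof eventually_elim
      case (elim N)
      then show ?case using b[of N] by (simp add: field_simps)
    qed
    show "(\<lambda>N. pmf p v + 1 / real N) \<longlonglongrightarrow> pmf p v"
      using tendsto_add[OF tendsto_const[of "pmf p v"] lim_1_over_n] by simp
  qed auto
  have image_sum: "image_mset f (\<Sum>v\<in>F. g v) = (\<Sum>v\<in>F. image_mset f (g v))"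
    for f :: "'w \<Rightarrow> 'a \<Rightarrow> nat" and g :: "'w \<Rightarrow> 'w multiset"
    using sum_comp_morphism[of "image_mset f" g F] by (simp add: comp_def)
  have cnt: "count (image_mset (key A) (M N)) x = K N A x" for A N x
    by (simp add: M_def K_def image_sum count_sum sum.inter_filter F eq_commute[of x] cong: if_cong)
  have setM: "set_mset (image_mset (key A) (M N)) = key A ` F" for A N
  proof -
    have "k N v \<noteq> 0" for v by (simp add: k_def)
    then have "set_mset (M N) = F" by (simp add: M_def set_mset_sum F)
    then show ?thesis by simp
  qed
  define n where "n = (\<lambda>N. \<Sum>v\<in>F. k N v)"
  have sizeM: "size (image_mset (key A) (M N)) = n N" for A N
    by (simp add: M_def n_def size_multiset_sum)
  have n_eq: "n N = (\<Sum>x\<in>key A ` F. K N A x)" for N A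
    unfolding n_def K_def by (rule sum.image_gen[OF F])
  have q_eq: "q N A / real N = S (n N) N - (\<Sum>x\<in>key A ` F. S (K N A x) N)" for N A
  proof -
    have r: "real (n N) = (\<Sum>x\<in>key A ` F. real (K N A x))" by (simp add: n_eq[of N A])
    have "(\<Sum>x\<in>key A ` F. S (K N A x) N) =
      ((\<Sum>x\<in>key A ` F. ln (fact (K N A x))) - real (n N) * ln (real N) + real (n N)) / real N"
      unfolding S_def sum_divide_distrib[symmetric] sum.distrib sum_subtractf sum_distrib_right[symmetric] r ..
    then show ?thesis
      unfolding q_def ln_card_permutations_of_multiset setM cnt sizeM S_def
      by (simp flip: diff_divide_distrib)
  qed
  have "(\<lambda>N. S (n N) N) \<longlonglongrightarrow> 1 * ln 1"
    unfolding S_def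
  proof (rule stirling_limit)
    have "(\<lambda>N. \<Sum>v\<in>F. real (k N v) / real N) \<longlonglongrightarrow> (\<Sum>v\<in>F. pmf p v)"
      by (intro tendsto_sum k_lim)
    then show "(\<lambda>N. real (n N) / real N) \<longlonglongrightarrow> 1"
      by (simp add: n_def sum_divide_distrib F_def sum_pmf_eq_1 fin)
  qed simp
  then have S_n: "(\<lambda>N. S (n N) N) \<longlonglongrightarrow> 0" by simp
  have S_K: "(\<lambda>N. S (K N A x) N) \<longlonglongrightarrow> P A x * ln (P A x)" if x: "x \<in> key A ` F" for A x
    unfolding S_def
  proof (rule stirling_limit)
    show "P A x > 0"
      unfolding P_def using x F by (intro sum_pos) (auto simp: F_def pmf_positive)
    have "(\<lambda>N. \<Sum>v\<in>{v \<in> F. key A v = x}. real (k N v) / real N) \<longlonglongrightarrow> P A x"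
      unfolding P_def by (intro tendsto_sum k_lim)
    then show "(\<lambda>N. real (K N A x) / real N) \<longlonglongrightarrow> P A x"
      by (simp add: K_def sum_divide_distrib)
  qed
  have lim: "(\<lambda>N. q N A / real N) \<longlonglongrightarrow> joint_entropy p X A" for A
  proof -
    have "(\<lambda>N. q N A / real N) \<longlonglongrightarrow> 0 - (\<Sum>x\<in>key A ` F. P A x * ln (P A x))"
      unfolding q_eq by (intro tendsto_diff S_n tendsto_sum S_K)
    then show ?thesis
      using joint_entropy_finite_support[OF fin, of X A] by (simp add: key_def P_def F_def)
  qed
  show ?thesis
    unfolding quasi_uniform_limit_def
  proof (intro allI impI)
    fix \<epsilon> :: real assume \<epsilon>: "\<epsilon> > 0"
    have "\<forall>A\<in>Pow E. \<forall>\<^sub>F N in sequentially. \<bar>q N A / real N - joint_entropy p X A\<bar> < \<epsilon>"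
      using tendstoD[OF lim \<epsilon>] by (simp add: dist_real_def)
    then have "\<forall>\<^sub>F N in sequentially. \<forall>A\<in>Pow E. \<bar>q N A / real N - joint_entropy p X A\<bar> < \<epsilon>"
      using E by (simp add: eventually_ball_finite)
    then show "\<forall>\<^sub>F N in sequentially. \<exists>q. quasi_uniform E q \<and>
        (\<forall>A\<subseteq>E. \<bar>real N * joint_entropy p X A - q A\<bar> \<le> \<epsilon> * real N)"
      using eventually_gt_at_top[of 0]
    proof eventually_elim
      case (elim N)
      have "\<bar>real N * joint_entropy p X A - q N A\<bar> \<le> \<epsilon> * real N" if "A \<subseteq> E" for A
      proof -
        have "real N * joint_entropy p X A - q N A = real N * (joint_entropy p X A - q N A / real N)"
          using elim(2) by (simp add: right_diff_distrib)
        then have "\<bar>real N * joint_entropy p X A - q N A\<bar> = real N * \<bar>q N A / real N - joint_entropy p X A\<bar>"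
          by (simp add: abs_mult abs_minus_commute)
        also have "\<dots> \<le> real N * \<epsilon>" using elim(1) that by (intro mult_left_mono) (auto intro: less_imp_le)
        finally show ?thesis by (simp add: mult.commute)
      qed
      moreover have "quasi_uniform E (q N)"
        unfolding q_def key_def by (rule quasi_uniform_permutations)
      ultimately show ?case by blast
    qed
  qed
qed

text \<open>
  Entropies of finite support are limits by the preceding lemma, all entropies by capping, their conic
  combinations because limits form a convex cone, and their closure because this cone is closed.
\<close>

lemma almost_entropic_cone_imp_quasi_uniform_limit:
  assumes E: "finite E" and h: "h \<in> almost_entropic_cone E"
  shows "quasi_uniform_limit E h"
proof -
  have entropic: "quasi_uniform_limit E g" if g: "entropic E g" for g
  proof -
    obtain p :: "('a \<Rightarrow> nat) pmf" where
      int: "\<And>A. A \<subseteq> E \<Longrightarrow> integrable (measure_pmf p) (\<lambda>v. - ln (measure_pmf.prob p {w. \<forall>e\<in>A. w e = v e}))" and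
      gA: "\<And>A. A \<subseteq> E \<Longrightarrow> g A = joint_entropy p (\<lambda>e \<omega>. \<omega> e) A / ln 2"
      using entropic_imp_joint_entropy[OF E g] by blast
    have "quasi_uniform_limit E (joint_entropy p (\<lambda>e \<omega>. \<omega> e))"
    proof (rule quasi_uniform_limit_closed)
      fix \<epsilon> :: real assume \<epsilon>: "\<epsilon> > 0"
      have "\<forall>A\<in>Pow E. \<forall>\<^sub>F m in sequentially.
          \<bar>joint_entropy p (\<lambda>e \<omega>. min (\<omega> e) m) A - joint_entropy p (\<lambda>e \<omega>. \<omega> e) A\<bar> < \<epsilon>"
      proof
        fix A assume "A \<in> Pow E"
        then have A: "A \<subseteq> E" "finite A" using E finite_subset by auto
        show "\<forall>\<^sub>F m in sequentially.
          \<bar>joint_entropy p (\<lambda>e \<omega>. min (\<omega> e) m) A - joint_entropy p (\<lambda>e \<omega>. \<omega> e) A\<bar> < \<epsilon>"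
          using tendstoD[OF joint_entropy_capped_tendsto[OF A(2) int[OF A(1)]] \<epsilon>] by (simp add: dist_real_def)
      qed
      then have "\<forall>\<^sub>F m in sequentially. \<forall>A\<in>Pow E.
          \<bar>joint_entropy p (\<lambda>e \<omega>. min (\<omega> e) m) A - joint_entropy p (\<lambda>e \<omega>. \<omega> e) A\<bar> < \<epsilon>"
        using E by (simp add: eventually_ball_finite)
      then obtain m where m: "\<And>A. A \<subseteq> E \<Longrightarrow>
          \<bar>joint_entropy p (\<lambda>e \<omega>. min (\<omega> e) m) A - joint_entropy p (\<lambda>e \<omega>. \<omega> e) A\<bar> < \<epsilon>"
        by (auto simp: eventually_sequentially)
      define p' where "p' = map_pmf (\<lambda>\<omega>. \<lambda>e\<in>E. min (\<omega> e) m) p"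
      have "set_pmf p' \<subseteq> E \<rightarrow>\<^sub>E {..m}" by (auto simp: p'_def)
      then have "finite (set_pmf p')"
        using E finite_PiE finite_subset by (metis finite_atMost)
      then have "quasi_uniform_limit E (joint_entropy p' (\<lambda>e \<omega>. \<omega> e))"
        by (rule quasi_uniform_limit_finite_support[OF E])
      moreover have "joint_entropy p' (\<lambda>e \<omega>. \<omega> e) A = joint_entropy p (\<lambda>e \<omega>. min (\<omega> e) m) A" if "A \<subseteq> E" for A
      proof -
        have "(\<forall>e\<in>A. (\<lambda>e\<in>E. min (w e) m) e = (\<lambda>e\<in>E. min (v e) m) e) \<longleftrightarrow>
           (\<forall>e\<in>A. min (w e) m = min (v e) m)" for v w :: "'a \<Rightarrow> nat"
          using that by auto
        then show ?thesis unfolding p'_def joint_entropy_map_pmf unfolding joint_entropy_def by simp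
      qed
      ultimately show "\<exists>g. quasi_uniform_limit E g \<and>
          (\<forall>A\<subseteq>E. \<bar>joint_entropy p (\<lambda>e \<omega>. \<omega> e) A - g A\<bar> \<le> \<epsilon>)"
        using m by (intro exI[of _ "joint_entropy p' (\<lambda>e \<omega>. \<omega> e)"]) (auto simp: abs_minus_commute less_imp_le)
    qed
    then have "quasi_uniform_limit E (\<lambda>A. 1 / ln 2 * joint_entropy p (\<lambda>e \<omega>. \<omega> e) A)"
      by (rule quasi_uniform_limit_scale[OF E]) simp
    then show ?thesis
      by (rule quasi_uniform_limit_cong) (simp add: gA)
  qed
  show ?thesis
  proof (rule quasi_uniform_limit_closed)
    fix \<epsilon> :: real assume "\<epsilon> > 0"
    then obtain g where g: "g \<in> entropic_conic_hull E" "\<And>A. A \<subseteq> E \<Longrightarrow> \<bar>h A - g A\<bar> < \<epsilon>"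
      using almost_entropic_cone_approx[OF E h] by blast
    from g(1) obtain n :: nat and c f where cf: "\<forall>i<n. 0 \<le> c i \<and> entropic E (f i)"
      "g = (\<lambda>A\<in>Pow E. \<Sum>i<n. c i * f i A)" unfolding entropic_conic_hull_def by blast
    have "quasi_uniform_limit E (\<lambda>A. \<Sum>i<n. c i * f i A)"
      using cf(1) entropic by (intro quasi_uniform_limit_sum[OF E]) auto
    then have "quasi_uniform_limit E g"
      by (rule quasi_uniform_limit_cong) (simp add: cf(2))
    then show "\<exists>g. quasi_uniform_limit E g \<and> (\<forall>A\<subseteq>E. \<bar>h A - g A\<bar> \<le> \<epsilon>)"
      using g(2) less_imp_le by blast
  qed
qed

section \<open>Random hashing and principal quotients\<close>

text \<open>
  Two distinct points receive the same colour with probability at most \<open>1 / K\<close>: a colouring with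
  \<open>g a = g b\<close> is determined by its restriction to the other points.
\<close>

lemma card_colourings_collision:
  assumes B: "finite B" "a \<in> B" "b \<in> B" "a \<noteq> b"
  shows "K * card {g \<in> B \<rightarrow>\<^sub>E {..<K::nat}. g a = g b} \<le> card (B \<rightarrow>\<^sub>E {..<K})"
proof -
  have "card {g \<in> B \<rightarrow>\<^sub>E {..<K}. g a = g b} \<le> card ((B - {a}) \<rightarrow>\<^sub>E {..<K})"
  proof (rule card_inj_on_le[of "\<lambda>g. restrict g (B - {a})"])
    show "inj_on (\<lambda>g. restrict g (B - {a})) {g \<in> B \<rightarrow>\<^sub>E {..<K}. g a = g b}"
    proof (rule inj_onI, elim CollectE conjE)
      fix g g' assume g: "g \<in> B \<rightarrow>\<^sub>E {..<K}" "g a = g b" "g' \<in> B \<rightarrow>\<^sub>E {..<K}" "g' a = g' b"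
        and eq: "restrict g (B - {a}) = restrict g' (B - {a})"
      have 1: "g x = g' x" if "x \<in> B - {a}" for x
        using fun_cong[OF eq, of x] that by simp
      then have "g a = g' a" using g B by simp
      then have "g x = g' x" if "x \<in> B" for x using 1 that by blast
      then show "g = g'" using g by (intro PiE_ext) auto
    qed
  qed (use B in \<open>auto simp: PiE_iff split: if_splits intro!: finite_PiE\<close>)
  then have "K * card {g \<in> B \<rightarrow>\<^sub>E {..<K}. g a = g b} \<le> K * card ((B - {a}) \<rightarrow>\<^sub>E {..<K})" by simp
  also have "\<dots> = K * K ^ (card B - 1)" using B by (simp add: card_PiE)
  also have "\<dots> = card (B \<rightarrow>\<^sub>E {..<K})"
  proof -
    have "card B > 0" using B(1,2) by (auto simp: card_gt_0_iff)
    then have "K ^ card B = K * K ^ (card B - 1)" by (simp add: power_eq_if)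
    then show ?thesis using B by (simp add: card_PiE)
  qed
  finally show ?thesis .
qed

lemma sum_inverse_card_class:
  assumes "finite V"
  shows "(\<Sum>v\<in>V. 1 / real (card {w \<in> V. f w = f v})) = real (card (f ` V))"
proof -
  have "(\<Sum>v\<in>V. 1 / real (card {w \<in> V. f w = f v})) =
    (\<Sum>y\<in>f ` V. \<Sum>v\<in>{w \<in> V. f w = y}. 1 / real (card {w \<in> V. f w = f v}))"
    by (rule sum.image_gen[OF assms])
  also have "\<dots> = (\<Sum>y\<in>f ` V. 1)"
  proof (rule sum.cong[OF refl])
    fix y assume "y \<in> f ` V"
    then have "card {w \<in> V. f w = y} \<noteq> 0" using assms by auto
    then show "(\<Sum>v\<in>{w \<in> V. f w = y}. 1 / real (card {w \<in> V. f w = f v})) = 1" by simp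
  qed
  finally show ?thesis by simp
qed

lemma exists_le_average:
  fixes F :: "'b \<Rightarrow> real"
  assumes "finite G" "G \<noteq> {}" "(\<Sum>g\<in>G. F g) \<le> real (card G) * c"
  shows "\<exists>g\<in>G. F g \<le> c"
proof (rule ccontr)
  assume "\<not> ?thesis"
  then have "(\<Sum>g\<in>G. c) < (\<Sum>g\<in>G. F g)"
    using assms by (intro sum_strict_mono) auto
  then show False using assms by simp
qed

text \<open>
  Colour the classes of \<open>L\<close> at random with \<open>K\<close> colours. A point \<open>w\<close> in the \<open>A\<close>-class of \<open>v\<close>
  certainly shares the colour of \<open>v\<close> if it lies in its \<open>L\<close>-class, and with probability at most \<open>1 / K\<close>
  otherwise. Hence the expected number of such points is at most \<open>\<phi> (A \<union> L) + \<phi> A / K\<close>. Averaging the sum over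
  all \<open>A \<subseteq> E\<close> of the ratios of both sides gives one colouring good for all \<open>A\<close>, at the price of the factor
  \<open>2 ^ card E\<close>.
\<close>

lemma exists_binning:
  fixes V :: "'w set" and X :: "'a \<Rightarrow> 'w \<Rightarrow> nat" and \<phi> :: "'a set \<Rightarrow> nat"
  assumes V: "finite V" "V \<noteq> {}" and E: "finite E" and L: "L \<subseteq> E" and K: "K > 0"
    and \<phi>: "\<And>A v. A \<subseteq> E \<Longrightarrow> v \<in> V \<Longrightarrow> card (cell X V A v) = \<phi> A"
  obtains f :: "'w \<Rightarrow> nat" where
    "\<And>v. v \<in> V \<Longrightarrow> f v < K"
    "\<And>v w. v \<in> V \<Longrightarrow> w \<in> cell X V L v \<Longrightarrow> f w = f v"
    "\<And>A. A \<subseteq> E \<Longrightarrow> (\<Sum>v\<in>V. real (card {w \<in> cell X V A v. f w = f v})) \<le>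
        2 ^ card E * real (card V) * (real (\<phi> (A \<union> L)) + real (\<phi> A) / real K)"
proof -
  define key where "key = (\<lambda>v. restrict (\<lambda>e. X e v) L)"
  define G where "G = (key ` V \<rightarrow>\<^sub>E {..<K})"
  define b where "b = (\<lambda>A. real (\<phi> (A \<union> L)) + real (\<phi> A) / real K)"
  define c where "c = (\<lambda>(g :: ('a \<Rightarrow> nat) \<Rightarrow> nat) A v.
    real (card {w \<in> cell X V A v. g (key w) = g (key v)}))"
  have G: "finite G" "G \<noteq> {}"
    using V K by (auto simp: G_def PiE_eq_empty_iff intro!: finite_PiE)
  have \<phi>_pos: "\<phi> A > 0" if A: "A \<subseteq> E" for A
  proof -
    obtain v where "v \<in> V" using V by blast
    then show ?thesis using card_cell_pos[OF V(1), of v X A] \<phi>[OF A] by simp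
  qed
  have b_pos: "b A > 0" if "A \<subseteq> E" for A
    using \<phi>_pos[of "A \<union> L"] that L by (auto simp: b_def intro!: add_pos_nonneg)
  have avg: "(\<Sum>g\<in>G. c g A v) \<le> real (card G) * b A" if A: "A \<subseteq> E" and v: "v \<in> V" for A v
  proof -
    have fc: "finite (cell X V A v)" using V(1) cell_subset finite_subset by metis
    have sub: "cell X V (A \<union> L) v \<subseteq> cell X V A v" by (auto simp: cell_def)
    have "(\<Sum>g\<in>G. c g A v) = (\<Sum>g\<in>G. \<Sum>w\<in>cell X V A v. if g (key w) = g (key v) then 1 else 0)"
      unfolding c_def using fc by (simp add: sum.inter_filter[symmetric])
    also have "\<dots> = (\<Sum>w\<in>cell X V A v. \<Sum>g\<in>G. if g (key w) = g (key v) then 1 else 0)"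
      by (rule sum.swap)
    also have "\<dots> = (\<Sum>w\<in>cell X V A v. real (card {g \<in> G. g (key w) = g (key v)}))"
      using G(1) by (simp add: sum.inter_filter[symmetric])
    also have "\<dots> \<le> (\<Sum>w\<in>cell X V A v. (if w \<in> cell X V (A \<union> L) v then real (card G) else 0) + real (card G) / real K)"
    proof (rule sum_mono)
      fix w assume w: "w \<in> cell X V A v"
      then have wV: "w \<in> V" by (auto simp: cell_def)
      show "real (card {g \<in> G. g (key w) = g (key v)}) \<le>
        (if w \<in> cell X V (A \<union> L) v then real (card G) else 0) + real (card G) / real K"
      proof (cases "w \<in> cell X V (A \<union> L) v")
        case True
        have "card {g \<in> G. g (key w) = g (key v)} \<le> card G" using G(1) by (intro card_mono) auto
        then show ?thesis using True by (simp add: add_increasing2)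
      next
        case False
        then have "key w \<noteq> key v"
          using w by (auto simp: key_def restrict_eq_iff_ball cell_def)
        then have "K * card {g \<in> G. g (key w) = g (key v)} \<le> card G"
          unfolding G_def using V(1) v wV by (intro card_colourings_collision) auto
        then have "real K * real (card {g \<in> G. g (key w) = g (key v)}) \<le> real (card G)"
          by (simp only: of_nat_mult[symmetric] of_nat_le_iff)
        then show ?thesis using False K by (simp add: field_simps)
      qed
    qed
    also have "\<dots> = real (card (cell X V (A \<union> L) v)) * real (card G) + real (card (cell X V A v)) * (real (card G) / real K)"
    proof -
      have "(\<Sum>w\<in>cell X V A v. if w \<in> cell X V (A \<union> L) v then real (card G) else 0) =
          (\<Sum>w\<in>cell X V (A \<union> L) v. real (card G))"
        using sub fc by (intro sum.mono_neutral_cong_right) auto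
      then show ?thesis by (simp only: sum.distrib sum_constant)
    qed
    also have "\<dots> = real (card G) * b A"
    proof -
      have "card (cell X V (A \<union> L) v) = \<phi> (A \<union> L)" using A L v by (intro \<phi>) auto
      then show ?thesis by (simp add: \<phi>[OF A v] b_def distrib_left mult.commute)
    qed
    finally show ?thesis .
  qed
  have "(\<Sum>g\<in>G. \<Sum>A\<in>Pow E. \<Sum>v\<in>V. c g A v / b A) = (\<Sum>A\<in>Pow E. \<Sum>g\<in>G. \<Sum>v\<in>V. c g A v / b A)"
    by (rule sum.swap)
  also have "\<dots> = (\<Sum>A\<in>Pow E. \<Sum>v\<in>V. \<Sum>g\<in>G. c g A v / b A)"
    by (intro sum.cong refl sum.swap)
  also have "\<dots> \<le> (\<Sum>A\<in>Pow E. \<Sum>v\<in>V. real (card G))"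
  proof (intro sum_mono)
    fix A v assume "A \<in> Pow E" "v \<in> V"
    then show "(\<Sum>g\<in>G. c g A v / b A) \<le> real (card G)"
      using avg[of A v] b_pos[of A] by (simp add: sum_divide_distrib[symmetric] divide_le_eq)
  qed
  also have "\<dots> = real (card G) * (2 ^ card E * real (card V))"
    using E by (simp add: card_Pow)
  finally have "\<exists>g\<in>G. (\<Sum>A\<in>Pow E. \<Sum>v\<in>V. c g A v / b A) \<le> 2 ^ card E * real (card V)"
    by (rule exists_le_average[OF G])
  then obtain g where g: "g \<in> G" "(\<Sum>A\<in>Pow E. \<Sum>v\<in>V. c g A v / b A) \<le> 2 ^ card E * real (card V)"
    by blast
  show ?thesis
  proof (rule that[of "\<lambda>v. g (key v)"])
    show "g (key v) < K" if "v \<in> V" for v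
      using g(1) that by (auto simp: G_def)
    show "g (key w) = g (key v)" if "w \<in> cell X V L v" for v w
    proof -
      have "key w = key v" using that by (simp add: key_def restrict_eq_iff_ball cell_def)
      then show ?thesis by simp
    qed
    fix A assume A: "A \<subseteq> E"
    have "(\<Sum>v\<in>V. c g A v / b A) \<le> (\<Sum>A\<in>Pow E. \<Sum>v\<in>V. c g A v / b A)"
      using A E b_pos
      by (intro member_le_sum[where f="\<lambda>A. \<Sum>v\<in>V. c g A v / b A"] sum_nonneg divide_nonneg_nonneg)
         (auto simp: c_def less_imp_le)
    also note g(2)
    finally have "(\<Sum>v\<in>V. c g A v) \<le> 2 ^ card E * real (card V) * b A"
      using b_pos[OF A] by (simp add: sum_divide_distrib[symmetric] divide_le_eq)
    then show "(\<Sum>v\<in>V. real (card {w \<in> cell X V A v. g (key w) = g (key v)})) \<le>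
        2 ^ card E * real (card V) * (real (\<phi> (A \<union> L)) + real (\<phi> A) / real K)"
      by (simp add: c_def b_def)
  qed
qed

lemma joint_entropy_pmf_of_set:
  assumes W: "finite W" "W \<noteq> {}"
  shows "joint_entropy (pmf_of_set W) X A =
    (\<Sum>v\<in>W. ln (real (card W)) - ln (real (card (cell X W A v)))) / real (card W)"
proof -
  have "joint_entropy (pmf_of_set W) X A =
     (\<Sum>v\<in>W. - ln (measure_pmf.prob (pmf_of_set W) {w. \<forall>e\<in>A. X e w = X e v})) / real (card W)"
    unfolding joint_entropy_def by (rule integral_pmf_of_set[OF W(2,1)])
  also have "(\<Sum>v\<in>W. - ln (measure_pmf.prob (pmf_of_set W) {w. \<forall>e\<in>A. X e w = X e v})) =
     (\<Sum>v\<in>W. ln (real (card W)) - ln (real (card (cell X W A v))))"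
  proof (rule sum.cong[OF refl])
    fix v assume v: "v \<in> W"
    have "W \<inter> {w. \<forall>e\<in>A. X e w = X e v} = cell X W A v" by (auto simp: cell_def)
    then have "measure_pmf.prob (pmf_of_set W) {w. \<forall>e\<in>A. X e w = X e v} = card (cell X W A v) / card W"
      using measure_pmf_of_set[OF W(2,1)] by simp
    moreover have "card (cell X W A v) > 0" "card W > 0"
      using card_cell_pos[OF W(1) v] W by (simp_all add: card_gt_0_iff[of W])
    ultimately show "- ln (measure_pmf.prob (pmf_of_set W) {w. \<forall>e\<in>A. X e w = X e v}) =
      ln (real (card W)) - ln (real (card (cell X W A v)))"
      by (simp add: ln_div)
  qed
  finally show ?thesis .
qed

lemma entropic_conic_hull_scale:
  assumes "g \<in> entropic_conic_hull E" "0 \<le> (c::real)"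
  shows "(\<lambda>A\<in>Pow E. c * g A) \<in> entropic_conic_hull E"
proof -
  from assms(1) obtain n :: nat and d f where df: "\<forall>i<n. 0 \<le> d i \<and> entropic E (f i)"
      "g = (\<lambda>A\<in>Pow E. \<Sum>i<n. d i * f i A)" unfolding entropic_conic_hull_def by blast
  have "(\<lambda>A\<in>Pow E. c * g A) = (\<lambda>A\<in>Pow E. \<Sum>i<n. (c * d i) * f i A)"
    unfolding df(2) by (auto simp: sum_distrib_left mult.assoc)
  then show ?thesis
    unfolding entropic_conic_hull_def using df(1) assms(2)
    by (intro CollectI exI[of _ n] exI[of _ "\<lambda>i. c * d i"] exI[of _ f]) auto
qed

text \<open>
  The displayed function is the entropy of the variables conditioned on the colour \<open>f\<close>, that is, the average over
  the colours of the entropies of the uniform distributions on the colour classes.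
\<close>

lemma conditional_entropy_in_conic_hull:
  fixes V :: "'w set" and f :: "'w \<Rightarrow> nat" and X :: "'a \<Rightarrow> 'w \<Rightarrow> nat"
  assumes V: "finite V" "V \<noteq> {}" and E: "finite E" and f: "\<And>v. v \<in> V \<Longrightarrow> f v < K"
  shows "(\<lambda>A\<in>Pow E. (\<Sum>v\<in>V. ln (real (card {w \<in> V. f w = f v})) -
            ln (real (card {w \<in> cell X V A v. f w = f v}))) / real (card V)) \<in> entropic_conic_hull E"
proof -
  define W where "W = (\<lambda>c. {v \<in> V. f v = c})"
  \<comment> \<open>Empty classes have weight 0; they are replaced so that a uniform distribution exists.\<close>
  define W' where "W' = (\<lambda>c. if W c = {} then V else W c)"
  \<comment> \<open>Entropic functions are in bits, the displayed function is in nats.\<close>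
  define d where "d = (\<lambda>c. ln 2 * real (card (W c)) / real (card V))"
  define h where "h = (\<lambda>c. \<lambda>A\<in>Pow E. joint_entropy (pmf_of_set (W' c)) X A / ln 2)"
  have fW: "finite (W c)" for c using V by (simp add: W_def)
  have W': "finite (W' c)" "W' c \<noteq> {}" for c using V fW by (auto simp: W'_def)
  have ent: "entropic E (h c)" for c
    unfolding h_def using W' by (intro entropic_finite_support[OF E]) simp
  have "(\<Sum>v\<in>V. ln (real (card {w \<in> V. f w = f v})) -
            ln (real (card {w \<in> cell X V A v. f w = f v}))) / real (card V) = (\<Sum>c<K. d c * h c A)"
    if A: "A \<in> Pow E" for A
  proof -
    let ?t = "\<lambda>v. ln (real (card {w \<in> V. f w = f v})) - ln (real (card {w \<in> cell X V A v. f w = f v}))"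
    have "(\<Sum>v\<in>V. ?t v) = (\<Sum>c<K. \<Sum>v\<in>{v \<in> V. f v = c}. ?t v)"
      using V f by (intro sum.group[symmetric]) auto
    also have "\<dots> = (\<Sum>c<K. real (card V) * (d c * h c A))"
    proof (rule sum.cong[OF refl])
      fix c
      have "?t v = ln (real (card (W c))) - ln (real (card (cell X (W c) A v)))" if "v \<in> W c" for v
      proof -
        have "{w \<in> V. f w = f v} = W c" "{w \<in> cell X V A v. f w = f v} = cell X (W c) A v"
          using that by (auto simp: W_def cell_def)
        then show ?thesis by simp
      qed
      then have "(\<Sum>v\<in>W c. ?t v) = (\<Sum>v\<in>W c. ln (real (card (W c))) - ln (real (card (cell X (W c) A v))))"
        by (rule sum.cong[OF refl])
      also have "\<dots> = real (card V) * (d c * h c A)"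
      proof (cases "W c = {}")
        case False
        then have "card (W c) > 0" "card V > 0" using fW V by (auto simp: card_gt_0_iff)
        then show ?thesis
          using A False joint_entropy_pmf_of_set[OF fW False, of X A]
          by (simp add: d_def h_def W'_def)
      qed (simp add: d_def)
      finally show "(\<Sum>v\<in>{v \<in> V. f v = c}. ?t v) = real (card V) * (d c * h c A)"
        by (simp only: W_def)
    qed
    finally show ?thesis using V by (simp add: sum_distrib_left[symmetric])
  qed
  then have eq: "(\<lambda>A\<in>Pow E. (\<Sum>v\<in>V. ln (real (card {w \<in> V. f w = f v})) -
            ln (real (card {w \<in> cell X V A v. f w = f v}))) / real (card V)) =
        (\<lambda>A\<in>Pow E. \<Sum>c<K. d c * h c A)" by auto
  have "\<forall>c<K. 0 \<le> d c \<and> entropic E (h c)" using ent by (auto simp: d_def)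
  then show ?thesis
    unfolding eq entropic_conic_hull_def by blast
qed

lemma abs_min_diff_le:
  fixes a b c d e :: real
  assumes "\<bar>a - c\<bar> \<le> e" "\<bar>b - d\<bar> \<le> e"
  shows "\<bar>min a b - min c d\<bar> \<le> e"
  using assms by linarith

text \<open>
  The heart of the argument. Colour the classes of \<open>L\<close> as above with about \<open>exp s\<close> colours and take the entropy
  conditioned on the colour. With \<open>G A v\<close> the size of the joint class of \<open>v\<close> for \<open>A\<close> and the colour, this is
  \<open>a {} - a A\<close>, where \<open>a A\<close> is the mean of \<open>ln (G A v)\<close>. The binning bound and the two trivial bounds show
  that \<open>a A\<close> is \<open>m A = max (ln (\<phi> (A \<union> L))) (ln (\<phi> A / K))\<close> up to a constant, which means that
  the colour is as independent of the variables in \<open>A\<close> as the entropy left in \<open>L\<close> permits. The error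
  does not depend on \<open>q\<close> and disappears on rescaling.
\<close>

lemma quotient_of_quasi_uniform:
  fixes s :: real
  assumes E: "finite E" and q: "quasi_uniform E q" and L: "L \<subseteq> E" and E': "E' \<subseteq> E" and s: "s \<ge> 0"
  shows "\<exists>g \<in> entropic_conic_hull E'. \<forall>A\<subseteq>E'.
     \<bar>g A - (min (q (A \<union> L)) (q A + s) - min (q L) s)\<bar> \<le> 2 ^ card E + 3 * ln 2"
proof -
  obtain V X where V: "finite V" "V \<noteq> {}"
     and qV: "\<forall>A\<subseteq>E. \<forall>v\<in>V. q A = ln (real (card V)) - ln (real (card (cell X V A (v::nat))))"
    using q unfolding quasi_uniform_def by blast
  obtain v0 where v0: "v0 \<in> V" using V by blast
  define \<phi> where "\<phi> = (\<lambda>A. card (cell X V A v0))"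
  have \<phi>_pos: "\<phi> A > 0" for A unfolding \<phi>_def by (rule card_cell_pos[OF V(1) v0])
  have q_eq: "q A = ln (real (card V)) - ln (real (\<phi> A))" if "A \<subseteq> E" for A
    using qV that v0 by (simp add: \<phi>_def)
  have \<phi>: "card (cell X V A v) = \<phi> A" if "A \<subseteq> E" "v \<in> V" for A v
  proof -
    have "ln (real (card (cell X V A v))) = ln (real (\<phi> A))"
      using qV[rule_format, OF that] q_eq[OF that(1)] by simp
    then show ?thesis using card_cell_pos[OF V(1) that(2), of X A] \<phi>_pos[of A] by simp
  qed
  define K where "K = nat \<lceil>exp s\<rceil>"
  have Kb: "exp s \<le> real K" "real K \<le> exp s + 1"
    using ceiling_correct[of "exp s"] by (simp_all add: K_def of_nat_nat)
  have e1: "exp s \<ge> 1" using s by simp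
  have K: "K > 0" using Kb(1) e1 by (auto intro!: gr0I)
  have lnK: "s \<le> ln (real K)" "ln (real K) \<le> s + ln 2"
  proof -
    show "s \<le> ln (real K)" using Kb(1) K by (simp add: ln_ge_iff)
    have "ln (real K) \<le> ln (exp s * 2)" proof -
      have "real K \<le> exp s * 2" using Kb(2) e1 by linarith
      then show ?thesis using K by (subst ln_le_cancel_iff) auto
    qed
    then show "ln (real K) \<le> s + ln 2" by (simp add: ln_mult)
  qed
  obtain f :: "nat \<Rightarrow> nat" where
    fK: "\<And>v. v \<in> V \<Longrightarrow> f v < K" and
    fL: "\<And>v w. v \<in> V \<Longrightarrow> w \<in> cell X V L v \<Longrightarrow> f w = f v" and
    fb: "\<And>A. A \<subseteq> E \<Longrightarrow> (\<Sum>v\<in>V. real (card {w \<in> cell X V A v. f w = f v})) \<le>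
        2 ^ card E * real (card V) * (real (\<phi> (A \<union> L)) + real (\<phi> A) / real K)"
    using exists_binning[OF V E L K \<phi>] by blast
  define G where "G = (\<lambda>A v. card {w \<in> cell X V A v. f w = f v})"
  define a where "a = (\<lambda>A. (\<Sum>v\<in>V. ln (real (G A v))) / real (card V))"
  define m where "m = (\<lambda>A. max (ln (real (\<phi> (A \<union> L)))) (ln (real (\<phi> A)) - ln (real K)))"
  have cV: "real (card V) > 0" using V by (simp add: card_gt_0_iff)
  have G_pos: "G A v > 0" if "v \<in> V" for A v
    using that V(1) by (auto simp: G_def card_gt_0_iff cell_def)
  \<comment> \<open>Points of the same class for \<open>A \<union> L\<close> have the same colour.\<close>
  have lower1: "ln (real (\<phi> (A \<union> L))) \<le> a A" if A: "A \<subseteq> E" for A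
  proof -
    have "ln (real (\<phi> (A \<union> L))) \<le> ln (real (G A v))" if v: "v \<in> V" for v
    proof -
      have "cell X V (A \<union> L) v \<subseteq> {w \<in> cell X V A v. f w = f v}"
        using fL[OF v] by (auto simp: cell_def)
      then have "card (cell X V (A \<union> L) v) \<le> G A v"
        unfolding G_def using V(1) by (intro card_mono) (auto simp: cell_def)
      then show ?thesis using \<phi>[of "A \<union> L" v] A L v \<phi>_pos[of "A \<union> L"] by simp
    qed
    then have "(\<Sum>v\<in>V. ln (real (\<phi> (A \<union> L)))) \<le> (\<Sum>v\<in>V. ln (real (G A v)))" by (rule sum_mono)
    then show ?thesis using cV by (simp add: a_def field_simps)
  qed
  \<comment> \<open>There are at most \<open>K\<close> times as many joint classes as classes for \<open>A\<close>, and
    \<open>ln x \<le> x - 1\<close> turns the count of classes into a bound on the mean logarithm.\<close>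
  have lower2: "ln (real (\<phi> A)) - ln (real K) \<le> a A" if A: "A \<subseteq> E" for A
  proof -
    define key where "key = (\<lambda>v. restrict (\<lambda>e. X e v) A)"
    define r where "r = real (\<phi> A) / real K"
    have r: "r > 0" using \<phi>_pos K by (simp add: r_def)
    have cell_key: "cell X V A v = {w \<in> V. key w = key v}" for v
      by (auto simp: cell_def key_def restrict_eq_iff_ball)
    have G_key: "G A v = card {w \<in> V. (key w, f w) = (key v, f v)}" for v
      by (auto simp: G_def cell_key intro!: arg_cong[where f=card])
    have "card V = card (key ` V) * \<phi> A"
      using \<phi>[OF A] by (intro card_eq_card_image_times V(1)) (simp add: cell_key)
    then have cVk: "real (card V) = real (card (key ` V)) * real (\<phi> A)" by simp
    have "(\<Sum>v\<in>V. 1 / real (G A v)) = real (card ((\<lambda>v. (key v, f v)) ` V))"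
      unfolding G_key by (rule sum_inverse_card_class[OF V(1)])
    also have "\<dots> \<le> real (card (key ` V \<times> {..<K}))"
      using V(1) fK by (intro of_nat_mono card_mono) auto
    also have "\<dots> = real (card (key ` V)) * real K" by (simp add: card_cartesian_product)
    finally have "r * (\<Sum>v\<in>V. 1 / real (G A v)) \<le> r * (real (card (key ` V)) * real K)"
      using r by (intro mult_left_mono) auto
    also have "\<dots> = real (card V)" using K by (simp add: r_def cVk)
    finally have le: "(\<Sum>v\<in>V. r / real (G A v)) \<le> real (card V)"
      by (simp add: sum_distrib_left)
    have "(\<Sum>v\<in>V. ln r - ln (real (G A v))) \<le> (\<Sum>v\<in>V. r / real (G A v) - 1)"
    proof (rule sum_mono)
      fix v assume v: "v \<in> V"
      have "ln (r / real (G A v)) \<le> r / real (G A v) - 1"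
        using r G_pos[OF v] by (intro ln_le_minus_one) simp
      then show "ln r - ln (real (G A v)) \<le> r / real (G A v) - 1"
        using r G_pos[OF v] by (simp add: ln_div)
    qed
    also have "\<dots> \<le> 0" using le by (simp add: sum_subtractf)
    finally have "real (card V) * ln r \<le> (\<Sum>v\<in>V. ln (real (G A v)))"
      by (simp add: sum_subtractf)
    then have "ln r \<le> a A" using cV by (simp add: a_def field_simps)
    then show ?thesis using \<phi>_pos[of A] K by (simp add: r_def ln_div)
  qed
  have lower: "m A \<le> a A" if "A \<subseteq> E" for A using lower1[OF that] lower2[OF that] by (simp add: m_def)
  \<comment> \<open>Here \<open>ln x \<le> x - 1\<close> is applied to \<open>G A v\<close> divided by its expected bound \<open>b\<close>.\<close>
  have upper: "a A \<le> m A + (2 ^ card E + ln 2)" if A: "A \<subseteq> E" for A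
  proof -
    define b where "b = real (\<phi> (A \<union> L)) + real (\<phi> A) / real K"
    have b: "b > 0" using \<phi>_pos K by (simp add: b_def add_pos_pos)
    have "(\<Sum>v\<in>V. ln (real (G A v)) - ln b) \<le> (\<Sum>v\<in>V. real (G A v) / b)"
    proof (rule sum_mono)
      fix v assume v: "v \<in> V"
      have "ln (real (G A v) / b) \<le> real (G A v) / b - 1"
        using b G_pos[OF v] by (intro ln_le_minus_one) simp
      then show "ln (real (G A v)) - ln b \<le> real (G A v) / b"
        using b G_pos[OF v] by (simp add: ln_div)
    qed
    also have "\<dots> \<le> 2 ^ card E * real (card V)"
      using fb[OF A] b by (simp add: G_def b_def sum_divide_distrib[symmetric] divide_le_eq)
    finally have "(\<Sum>v\<in>V. ln (real (G A v))) \<le> (ln b + 2 ^ card E) * real (card V)"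
      by (simp add: sum_subtractf algebra_simps)
    then have 1: "a A \<le> ln b + 2 ^ card E" using cV by (simp add: a_def divide_le_eq)
    have x: "real (\<phi> (A \<union> L)) > 0" "real (\<phi> A) / real K > 0" using \<phi>_pos K by auto
    have "b \<le> 2 * exp (m A)"
    proof -
      have "real (\<phi> (A \<union> L)) \<le> exp (m A)"
        using x(1) by (subst ln_le_cancel_iff[symmetric]) (auto simp: m_def)
      moreover have "real (\<phi> A) / real K \<le> exp (m A)"
        using x(2) \<phi>_pos[of A] K by (subst ln_le_cancel_iff[symmetric]) (auto simp: m_def ln_div)
      ultimately show ?thesis by (simp add: b_def)
    qed
    then have "ln b \<le> ln (2 * exp (m A))" using b by simp
    also have "\<dots> = ln 2 + m A" by (simp add: ln_mult)
    finally show ?thesis using 1 by simp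
  qed
  define g where "g = (\<lambda>A\<in>Pow E'. (\<Sum>v\<in>V. ln (real (card {w \<in> V. f w = f v})) -
            ln (real (card {w \<in> cell X V A v. f w = f v}))) / real (card V))"
  have g_hull: "g \<in> entropic_conic_hull E'"
    unfolding g_def using E E' finite_subset fK by (intro conditional_entropy_in_conic_hull[OF V]) auto
  have "\<bar>g A - (min (q (A \<union> L)) (q A + s) - min (q L) s)\<bar> \<le> 2 ^ card E + 3 * ln 2" if A': "A \<subseteq> E'" for A
  proof -
    have A: "A \<subseteq> E" "A \<union> L \<subseteq> E" using A' E' L by auto
    have cell0: "cell X V {} v = V" for v by (auto simp: cell_def)
    have gA: "g A = a {} - a A"
      using A' by (simp add: g_def a_def G_def cell0 sum_subtractf diff_divide_distrib)
    have \<phi>0: "\<phi> {} = card V" by (simp add: \<phi>_def cell0)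
    have mA: "m A = ln (real (card V)) - min (q (A \<union> L)) (q A + ln (real K))"
      using q_eq[OF A(1)] q_eq[OF A(2)] unfolding m_def by linarith
    have m0: "m {} = ln (real (card V)) - min (q L) (ln (real K))"
      using q_eq[OF L] \<phi>0 unfolding m_def by simp
    have "\<bar>(a {} - a A) - (m {} - m A)\<bar> \<le> 2 ^ card E + ln 2"
      using lower[of "{}"] upper[of "{}"] lower[OF A(1)] upper[OF A(1)] by (simp add: abs_le_iff)
    moreover have "\<bar>(m {} - m A) - (min (q (A \<union> L)) (q A + s) - min (q L) s)\<bar> \<le> 2 * ln 2"
    proof -
      have "\<bar>min (q (A \<union> L)) (q A + ln (real K)) - min (q (A \<union> L)) (q A + s)\<bar> \<le> ln 2"
        "\<bar>min (q L) (ln (real K)) - min (q L) s\<bar> \<le> ln 2"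
        by (rule abs_min_diff_le; use lnK in simp)+
      moreover have "\<bar>((v - b) - (v - a)) - (c - d)\<bar> \<le> 2 * l"
        if "\<bar>a - c\<bar> \<le> l" "\<bar>b - d\<bar> \<le> l" for a b c d l v :: real
        using that by linarith
      ultimately show ?thesis unfolding mA m0 by blast
    qed
    ultimately show ?thesis unfolding gA by (simp add: abs_le_iff)
  qed
  then show ?thesis using g_hull by blast
qed

text \<open>
  For \<open>t = 1\<close> and the rank function \<open>h\<close> of a matroid this is the quotient obtained by adding a point freely to
  the flat spanned by \<open>L\<close> and contracting it. The hypothesis \<open>t \<le> h L\<close> says that the point really has
  weight \<open>t\<close>, that is, that the colour is nearly uniform. The case \<open>L = {}\<close>, \<open>t = 0\<close> returns \<open>h\<close> itself
  and shows that limits of quasi-uniform functions are almost entropic.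
\<close>

lemma principal_quotient_in_almost_entropic_cone:
  fixes t :: real
  assumes E: "finite E" and h: "quasi_uniform_limit E h" and L: "L \<subseteq> E" and E': "E' \<subseteq> E"
    and t: "0 \<le> t" "t \<le> h L"
  shows "(\<lambda>A\<in>Pow E'. min (h A) (h (A \<union> L) - t)) \<in> almost_entropic_cone E'"
proof (rule almost_entropic_coneI)
  show "finite E'" using E E' finite_subset by blast
  fix \<epsilon> :: real assume "\<epsilon> > 0"
  \<comment> \<open>The error has three parts of size \<open>\<delta>\<close>: from \<open>N h - q\<close> at \<open>A\<close> and \<open>A \<union> L\<close>, from \<open>N h - q\<close> at \<open>L\<close>,
    and from the constant \<open>D\<close> of the preceding lemma.\<close>
  define \<delta> where "\<delta> = \<epsilon> / 4"
  have \<delta>: "\<delta> > 0" using \<open>\<epsilon> > 0\<close> by (simp add: \<delta>_def)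
  define D where "D = 2 ^ card E + 3 * ln (2::real)"
  have D: "D \<ge> 0" by (simp add: D_def)
  have "\<forall>\<^sub>F N in sequentially. \<exists>q. quasi_uniform E q \<and> (\<forall>A\<subseteq>E. \<bar>real N * h A - q A\<bar> \<le> \<delta> * real N)"
    using h \<delta> unfolding quasi_uniform_limit_def by blast
  moreover have "\<forall>\<^sub>F N in sequentially. D / \<delta> \<le> real N"
    using filterlim_real_sequentially by (auto simp: filterlim_at_top)
  moreover note eventually_gt_at_top[of "0::nat"]
  ultimately have "\<forall>\<^sub>F N in sequentially. (\<exists>q. quasi_uniform E q \<and> (\<forall>A\<subseteq>E. \<bar>real N * h A - q A\<bar> \<le> \<delta> * real N))
      \<and> D / \<delta> \<le> real N \<and> 0 < N" by eventually_elim blast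
  then obtain N :: nat and q where q: "quasi_uniform E q"
    and qh: "\<And>A. A \<subseteq> E \<Longrightarrow> \<bar>real N * h A - q A\<bar> \<le> \<delta> * real N"
    and N: "D / \<delta> \<le> real N" "0 < N"
    unfolding eventually_sequentially by blast
  define s where "s = real N * t"
  have s: "s \<ge> 0" using t by (simp add: s_def)
  obtain g where g: "g \<in> entropic_conic_hull E'"
    "\<And>A. A \<subseteq> E' \<Longrightarrow> \<bar>g A - (min (q (A \<union> L)) (q A + s) - min (q L) s)\<bar> \<le> D"
    using quotient_of_quasi_uniform[OF E q L E' s] unfolding D_def by blast
  have DN: "D \<le> \<delta> * real N" using N \<delta> by (simp add: divide_le_eq mult.commute)
  have NL: "s \<le> real N * h L" using t(2) by (simp add: s_def mult_left_mono)
  show "\<exists>g\<in>entropic_conic_hull E'. \<forall>A\<subseteq>E'. \<bar>(\<lambda>A\<in>Pow E'. min (h A) (h (A \<union> L) - t)) A - g A\<bar> < \<epsilon>"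
  proof (intro bexI[of _ "\<lambda>A\<in>Pow E'. (1 / real N) * g A"] allI impI)
    show "(\<lambda>A\<in>Pow E'. 1 / real N * g A) \<in> entropic_conic_hull E'"
      using g(1) by (rule entropic_conic_hull_scale) simp
    fix A assume A': "A \<subseteq> E'"
    have A: "A \<subseteq> E" "A \<union> L \<subseteq> E" using A' E' L by auto
    have Nmin: "real N * min (h A) (h (A \<union> L) - t) = min (real N * h A) (real N * h (A \<union> L) - s)"
      using N(2) by (simp add: s_def min_mult_distrib_left right_diff_distrib)
    have "\<bar>min (real N * h A) (real N * h (A \<union> L) - s) - g A\<bar> \<le> 3 * (\<delta> * real N)"
    proof -
      let ?d = "\<delta> * real N"
      have d: "0 \<le> ?d" using \<delta> by simp
      have qs: "\<bar>min (real N * h L) s - min (q L) s\<bar> \<le> ?d"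
        by (rule abs_min_diff_le) (use qh[OF L] d in auto)
      have "\<bar>min (real N * h A) (real N * h (A \<union> L) - s) - min (q A) (q (A \<union> L) - s)\<bar> \<le> ?d"
        by (rule abs_min_diff_le) (use qh[OF A(1)] qh[OF A(2)] in auto)
      moreover have "\<bar>s - min (q L) s\<bar> \<le> ?d" using qs NL by (simp add: min_absorb2)
      moreover have "min (q (A \<union> L)) (q A + s) = min (q A) (q (A \<union> L) - s) + s"
        by (simp add: min_def)
      moreover have "\<bar>X - c\<bar> \<le> 3 * d" if "\<bar>c - (m - m')\<bar> \<le> D" "\<bar>X - m''\<bar> \<le> d" "\<bar>s - m'\<bar> \<le> d"
        "m = m'' + s" "D \<le> d" for X c d m m' m'' :: real
        using that by linarith
      ultimately show ?thesis using g(2)[OF A'] DN by blast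
    qed
    then have "\<bar>real N * (min (h A) (h (A \<union> L) - t) - 1 / real N * g A)\<bar> \<le> 3 * (\<delta> * real N)"
      using N(2) by (simp add: Nmin right_diff_distrib)
    then have "\<bar>min (h A) (h (A \<union> L) - t) - 1 / real N * g A\<bar> \<le> 3 * \<delta>"
      using N(2) by (simp add: abs_mult)
    also have "\<dots> < \<epsilon>" using \<open>\<epsilon> > 0\<close> by (simp add: \<delta>_def)
    finally show "\<bar>(\<lambda>A\<in>Pow E'. min (h A) (h (A \<union> L) - t)) A - (\<lambda>A\<in>Pow E'. 1 / real N * g A) A\<bar> < \<epsilon>"
      using A' by simp
  qed
qed auto

section \<open>The rank function of an identification\<close>

lemma ground_mk_ranked [simp]: "ground (mk_ranked E f) = E"
  by (simp add: mk_ranked_def)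

lemma rk_mk_ranked: "S \<subseteq> E \<Longrightarrow> rk (mk_ranked E f) S = f S"
  by (simp add: mk_ranked_def)

lemma rk_mk_ranked_extensional: "rk (mk_ranked E f) \<in> extensional (Pow (ground (mk_ranked E f)))"
  by (simp add: mk_ranked_def)

lemma finite_ground: "matroid M \<Longrightarrow> finite (ground M)"
  by (simp add: matroid_def)

lemma rk_mono: "matroid M \<Longrightarrow> S \<subseteq> T \<Longrightarrow> T \<subseteq> ground M \<Longrightarrow> rk M S \<le> rk M T"
  by (simp add: matroid_def)

lemma rk_le_card: "matroid M \<Longrightarrow> S \<subseteq> ground M \<Longrightarrow> rk M S \<le> card S"
  by (simp add: matroid_def)

lemma rk_empty: "matroid M \<Longrightarrow> rk M {} = 0"
  using rk_le_card[of M "{}"] by simp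

lemma rk_submodular: "matroid M \<Longrightarrow> S \<subseteq> ground M \<Longrightarrow> T \<subseteq> ground M \<Longrightarrow>
    rk M (S \<union> T) + rk M (S \<inter> T) \<le> rk M S + rk M T"
  by (simp add: matroid_def)

lemma rk_union_le_add:
  assumes "matroid M" "S \<subseteq> ground M" "T \<subseteq> ground M"
  shows "rk M (S \<union> T) \<le> rk M S + card T"
  using rk_submodular[OF assms] rk_le_card[OF assms(1,3)] by linarith

text \<open>
  Diminishing returns: adding \<open>T\<close> raises the rank of a larger set by at most as much.
\<close>

lemma rk_union_increment:
  assumes M: "matroid M" and S: "S \<subseteq> A" "A \<subseteq> B" "B \<subseteq> ground M" and T: "T \<subseteq> ground M"
  shows "rk M (B \<union> T) + rk M A \<le> rk M (A \<union> T) + rk M B"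
proof -
  have AT: "A \<union> T \<subseteq> ground M" using S T by auto
  have "rk M ((A \<union> T) \<union> B) + rk M ((A \<union> T) \<inter> B) \<le> rk M (A \<union> T) + rk M B"
    by (rule rk_submodular[OF M AT S(3)])
  moreover have "rk M A \<le> rk M ((A \<union> T) \<inter> B)" by (rule rk_mono[OF M]) (use S in auto)
  moreover have "(A \<union> T) \<union> B = B \<union> T" using S by auto
  ultimately show ?thesis by simp
qed

lemma rk_insert_subset:
  assumes M: "matroid M" and S: "S \<subseteq> T" "insert e T \<subseteq> ground M" 
    and e: "rk M (insert e T) = Suc (rk M T)"
  shows "rk M (insert e S) = Suc (rk M S)"
proof -
  have "rk M (T \<union> {e}) + rk M S \<le> rk M (S \<union> {e}) + rk M T"
    by (rule rk_union_increment[OF M subset_refl]) (use S in auto)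
  moreover have "rk M (S \<union> {e}) \<le> rk M S + card {e}"
    by (rule rk_union_le_add[OF M]) (use S in auto)
  ultimately show ?thesis using e by simp
qed

text \<open>
  If adding the set \<open>B\<close> to \<open>A\<close> raises the rank by the largest possible amount, then each of its elements
  still raises the rank when it is added last.
\<close>

lemma rk_insert_of_rk_union_eq:
  assumes M: "matroid M" and A: "A \<subseteq> ground M" and B: "B \<subseteq> ground M" "finite B" and e: "e \<in> B"
    and full: "rk M (A \<union> B) \<ge> rk M A + card B"
  shows "rk M (A \<union> (B - {e})) = rk M A + (card B - 1)"
    and "rk M (insert e (A \<union> (B - {e}))) = Suc (rk M (A \<union> (B - {e})))"
proof -
  have c: "card B > 0" using B e by (auto simp: card_gt_0_iff)
  have AB: "A \<union> B = (A \<union> (B - {e})) \<union> {e}" using e by auto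
  have 1: "rk M (A \<union> (B - {e})) \<le> rk M A + card (B - {e})"
    by (rule rk_union_le_add[OF M A]) (use B in auto)
  have 2: "rk M ((A \<union> (B - {e})) \<union> {e}) \<le> rk M (A \<union> (B - {e})) + card {e}"
    by (rule rk_union_le_add[OF M]) (use A B e in auto)
  show "rk M (A \<union> (B - {e})) = rk M A + (card B - 1)"
    "rk M (insert e (A \<union> (B - {e}))) = Suc (rk M (A \<union> (B - {e})))"
    using 1 2 full[unfolded AB] c e B by (simp_all add: card_Diff_singleton)
qed

lemma cl_subset_cl_iff:
  assumes M: "matroid M" and S: "S \<subseteq> ground M" and P: "P \<subseteq> ground M" "finite P"
  shows "cl M P \<subseteq> cl M S \<longleftrightarrow> rk M (S \<union> P) = rk M S"
proof
  assume sub: "cl M P \<subseteq> cl M S"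
  have "rk M (S \<union> Q) = rk M S" if "finite Q" "Q \<subseteq> P" for Q
    using that
  proof (induction Q rule: finite_induct)
    case (insert e Q)
    have "e \<in> cl M P" using insert.prems P by (auto simp: cl_def insert_absorb)
    then have e: "rk M (insert e S) = rk M S" using sub by (auto simp: cl_def)
    have "rk M ((S \<union> Q) \<union> {e}) + rk M S \<le> rk M (S \<union> {e}) + rk M (S \<union> Q)"
      by (rule rk_union_increment[OF M subset_refl]) (use S P insert.prems in auto)
    moreover have "rk M S \<le> rk M (S \<union> insert e Q)"
      by (rule rk_mono[OF M]) (use S P insert.prems in auto)
    ultimately show ?case using e insert by simp
  qed simp
  then show "rk M (S \<union> P) = rk M S" using P by blast
next
  assume eq: "rk M (S \<union> P) = rk M S"
  show "cl M P \<subseteq> cl M S"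
  proof
    fix e assume "e \<in> cl M P"
    then have e: "e \<in> ground M" "rk M (insert e P) = rk M P" by (auto simp: cl_def)
    have "rk M ((S \<union> P) \<union> {e}) + rk M P \<le> rk M (P \<union> {e}) + rk M (S \<union> P)"
      by (rule rk_union_increment[OF M subset_refl]) (use S P e in auto)
    then have "rk M ((S \<union> P) \<union> {e}) \<le> rk M S" using e eq by simp
    moreover have "rk M (insert e S) \<le> rk M ((S \<union> P) \<union> {e})" "rk M S \<le> rk M (insert e S)"
      by (rule rk_mono[OF M]; use S P e in auto)+
    ultimately show "e \<in> cl M S" using e by (simp add: cl_def)
  qed
qed

lemma rk_relabel_Some:
  assumes "S \<subseteq> ground M"
  shows "rk (relabel Some M) (Some ` S) = rk M S"
proof -
  have "{e \<in> ground M. Some e \<in> Some ` S} = S" using assms by auto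
  then show ?thesis using assms by (simp add: relabel_def rk_mk_ranked image_mono)
qed

lemma cl_relabel_Some:
  assumes "S \<subseteq> ground M"
  shows "cl (relabel Some M) (Some ` S) = Some ` cl M S"
proof -
  have "rk (relabel Some M) (insert (Some e) (Some ` S)) = rk M (insert e S)" if "e \<in> ground M" for e
    using rk_relabel_Some[of "insert e S" M] assms that by simp
  then show ?thesis using rk_relabel_Some[OF assms] by (auto simp: cl_def relabel_def)
qed

lemma ground_identify [simp]: fixes M :: "'a ranked_set" shows "ground (identify M x y) = ground M - {y}"
proof -
  have "the ` (insert None (Some ` E) - {None} - {Some y}) = E - {y}" for E :: "'a set"
  proof -
    have "insert None (Some ` E) - {None} - {Some y} = Some ` (E - {y})" by auto
    then show ?thesis by (simp add: image_image)
  qed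
  then show ?thesis
    by (simp add: identify_def Let_def relabel_def delete_def contract_def principal_extension_def)
qed

text \<open>
  The new point \<open>e\<close> is spanned by \<open>S\<close> exactly if \<open>x\<close> and \<open>y\<close> are, so contracting \<open>e\<close> lowers the rank of
  \<open>S\<close> by one in that case only. Writing this as a minimum makes the link to entropy, and
  submodularity, immediate.
\<close>

lemma rk_identify:
  assumes M: "matroid M" and xy: "independent_in M {x, y}" "x \<noteq> y" and S: "S \<subseteq> ground M - {y}"
  shows "rk (identify M x y) S = min (rk M S) (rk M (S \<union> {x, y}) - 1)"
proof -
  define M' where "M' = relabel Some M"
  define L where "L = cl M' {Some x, Some y}"
  define N where "N = principal_extension M' L None"
  have P: "{x, y} \<subseteq> ground M" and r2: "rk M {x, y} = 2"
    using xy by (auto simp: independent_in_def)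
  have L: "L = Some ` cl M {x, y}"
    using cl_relabel_Some[OF P] by (simp add: L_def M'_def)
  have rkN: "rk N (insert None (Some ` T)) =
      (if rk M (T \<union> {x, y}) = rk M T then rk M T else rk M T + 1)" if T: "T \<subseteq> ground M" for T
  proof -
    have "L \<subseteq> cl M' (Some ` T) \<longleftrightarrow> rk M (T \<union> {x, y}) = rk M T"
      using cl_subset_cl_iff[OF M T P] cl_relabel_Some[OF T] by (simp add: L M'_def inj_image_subset_iff)
    moreover have "insert None (Some ` T) \<subseteq> insert None (ground M')"
      using T by (auto simp: M'_def relabel_def)
    moreover have "insert None (Some ` T) - {None} = Some ` T" by auto
    ultimately show ?thesis
      using rk_relabel_Some[OF T] by (simp add: N_def principal_extension_def rk_mk_ranked M'_def)
  qed
  \<comment> \<open>The new point is no loop because \<open>{x, y}\<close> has positive rank.\<close>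
  have N0: "rk N {None} = 1" using rkN[of "{}"] r2 rk_empty[OF M] by simp
  have gN: "ground N = insert None (Some ` ground M)"
    by (simp add: N_def principal_extension_def M'_def relabel_def)
  have gD: "ground (delete (contract N {None}) {Some y}) = Some ` ground M - {Some y}"
    by (auto simp: delete_def contract_def gN)
  have img: "the ` (Some ` ground M - {Some y}) = ground M - {y}"
    using ground_identify[of M x y]
    unfolding identify_def Let_def N_def[symmetric] L_def[symmetric] M'_def[symmetric]
    unfolding relabel_def ground_mk_ranked gD .
  have "rk (identify M x y) S = rk (delete (contract N {None}) {Some y})
      {e \<in> Some ` ground M - {Some y}. the e \<in> S}"
    unfolding identify_def Let_def N_def[symmetric] L_def[symmetric] M'_def[symmetric]
    unfolding relabel_def gD using S img by (intro rk_mk_ranked) simp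
  also have "{e \<in> Some ` ground M - {Some y}. the e \<in> S} = Some ` S"
    using S by auto
  also have "rk (delete (contract N {None}) {Some y}) (Some ` S) = rk N (insert None (Some ` S)) - rk N {None}"
  proof -
    have "Some ` S \<subseteq> ground N - {None} - {Some y}" "Some ` S \<subseteq> ground N - {None}"
      using S by (auto simp: gN)
    then show ?thesis by (simp add: delete_def contract_def rk_mk_ranked)
  qed
  also have "\<dots> = min (rk M S) (rk M (S \<union> {x, y}) - 1)"
  proof -
    have SM: "S \<subseteq> ground M" using S by auto
    have "rk M S \<le> rk M (S \<union> {x, y})" "rk M {x, y} \<le> rk M (S \<union> {x, y})"
      by (rule rk_mono[OF M]; use S P in auto)+
    then show ?thesis unfolding rkN[OF SM] N0 using r2 by auto
  qed
  finally show ?thesis .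
qed

lemma min_add_min_le:
  fixes a :: nat
  assumes "c + d \<le> a + b" "c' + d \<le> a' + b" "c' + d \<le> a + b'" "c' + d' \<le> a' + b'"
  shows "min c c' + min d d' \<le> min a a' + min b b'"
proof -
  have "min a a' = a \<or> min a a' = a'" "min b b' = b \<or> min b b' = b'" by (auto simp: min_def)
  moreover have "min c c' \<le> c" "min c c' \<le> c'" "min d d' \<le> d" "min d d' \<le> d'" by simp_all
  ultimately show ?thesis using assms by (elim disjE) linarith+
qed

lemma matroid_identify:
  assumes M: "matroid M" and xy: "independent_in M {x, y}" "x \<noteq> y"
  shows "matroid (identify M x y)"
  unfolding matroid_def
proof (intro conjI allI impI)
  let ?P = "{x, y}"
  have P: "?P \<subseteq> ground M" and r2: "rk M ?P = 2" using xy by (auto simp: independent_in_def)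
  note r = rk_identify[OF M xy]
  show "finite (ground (identify M x y))" using finite_ground[OF M] by simp
  show "rk (identify M x y) \<in> extensional (Pow (ground (identify M x y)))"
    unfolding identify_def Let_def relabel_def by (rule rk_mk_ranked_extensional)
  fix S assume "S \<subseteq> ground (identify M x y)"
  then have S: "S \<subseteq> ground M - {y}" "S \<subseteq> ground M" by auto
  show "rk (identify M x y) S \<le> card S"
    using r[OF S(1)] rk_le_card[OF M S(2)] by simp
next
  let ?P = "{x, y}"
  have P: "?P \<subseteq> ground M" using xy by (auto simp: independent_in_def)
  note r = rk_identify[OF M xy]
  fix S T assume ST: "S \<subseteq> T \<and> T \<subseteq> ground (identify M x y)"
  then have sub: "S \<subseteq> ground M - {y}" "T \<subseteq> ground M - {y}" by auto
  have "rk M S \<le> rk M T" "rk M (S \<union> ?P) \<le> rk M (T \<union> ?P)"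
    by (rule rk_mono[OF M]; use ST P sub in auto)+
  then show "rk (identify M x y) S \<le> rk (identify M x y) T"
    unfolding r[OF sub(1)] r[OF sub(2)] by (intro min.mono diff_le_mono)
next
  let ?P = "{x, y}"
  have P: "?P \<subseteq> ground M" and r2: "rk M ?P = 2" using xy by (auto simp: independent_in_def)
  note r = rk_identify[OF M xy]
  fix S T assume ST: "S \<subseteq> ground (identify M x y) \<and> T \<subseteq> ground (identify M x y)"
  then have sub: "S \<subseteq> ground M - {y}" "T \<subseteq> ground M - {y}" "S \<union> T \<subseteq> ground M - {y}" "S \<inter> T \<subseteq> ground M - {y}"
    and sub': "S \<subseteq> ground M" "T \<subseteq> ground M" by auto
  have big: "rk M (U \<union> ?P) \<ge> 2" if "U \<subseteq> ground M" for U
    using rk_mono[OF M, of ?P "U \<union> ?P"] that P r2 by auto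
  have mono: "rk M (S \<inter> T) \<le> rk M ((S \<union> ?P) \<inter> T)" "rk M (S \<inter> T) \<le> rk M (S \<inter> (T \<union> ?P))"
    by (rule rk_mono[OF M]; use P sub in auto)+
  have SP: "S \<union> ?P \<subseteq> ground M" and TP: "T \<union> ?P \<subseteq> ground M" using sub' P by auto
  have e: "(S \<union> ?P) \<union> T = (S \<union> T) \<union> ?P" "S \<union> (T \<union> ?P) = (S \<union> T) \<union> ?P"
    "(S \<union> ?P) \<union> (T \<union> ?P) = (S \<union> T) \<union> ?P" "(S \<union> ?P) \<inter> (T \<union> ?P) = (S \<inter> T) \<union> ?P" by auto
  note sm = rk_submodular[OF M sub'] rk_submodular[OF M SP sub'(2), unfolded e]
    rk_submodular[OF M sub'(1) TP, unfolded e] rk_submodular[OF M SP TP, unfolded e]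
  have "S \<union> T \<subseteq> ground M" "S \<inter> T \<subseteq> ground M" using sub' by auto
  note bigs = big[OF sub'(1)] big[OF sub'(2)] big[OF this(1)] big[OF this(2)]
  show "rk (identify M x y) (S \<union> T) + rk (identify M x y) (S \<inter> T)
      \<le> rk (identify M x y) S + rk (identify M x y) T"
    unfolding r[OF sub(1)] r[OF sub(2)] r[OF sub(3)] r[OF sub(4)]
  proof (rule min_add_min_le)
    show "rk M (S \<union> T) + rk M (S \<inter> T) \<le> rk M S + rk M T" by (rule sm)
    show "(rk M (S \<union> T \<union> ?P) - 1) + rk M (S \<inter> T) \<le> (rk M (S \<union> ?P) - 1) + rk M T"
      using sm(2) mono bigs by linarith
    show "(rk M (S \<union> T \<union> ?P) - 1) + rk M (S \<inter> T) \<le> rk M S + (rk M (T \<union> ?P) - 1)"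
      using sm(3) mono bigs by linarith
    show "(rk M (S \<union> T \<union> ?P) - 1) + (rk M (S \<inter> T \<union> ?P) - 1) \<le> (rk M (S \<union> ?P) - 1) + (rk M (T \<union> ?P) - 1)"
      using sm(4) bigs by linarith
  qed
qed

lemma ground_direct_sum [simp]: "ground (direct_sum M N) = ground M \<union> ground N"
  by (simp add: direct_sum_def)

lemma rk_direct_sum:
  "S \<subseteq> ground M \<union> ground N \<Longrightarrow>
   rk (direct_sum M N) S = rk M (S \<inter> ground M) + rk N (S \<inter> ground N)"
  by (simp add: direct_sum_def rk_mk_ranked)

lemma matroid_direct_sum:
  assumes M: "matroid M" and N: "matroid N" and disj: "ground M \<inter> ground N = {}"
  shows "matroid (direct_sum M N)"
  unfolding matroid_def
proof (intro conjI allI impI)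
  show "finite (ground (direct_sum M N))" using M N by (simp add: matroid_def)
  show "rk (direct_sum M N) \<in> extensional (Pow (ground (direct_sum M N)))"
    by (simp add: direct_sum_def mk_ranked_def)
next
  fix S assume S: "S \<subseteq> ground (direct_sum M N)"
  have f: "finite S" using S M N finite_subset by (fastforce simp: matroid_def)
  have "card S = card (S \<inter> ground M) + card (S \<inter> ground N)"
    using f disj S by (subst card_Un_disjoint[symmetric]) (auto intro!: arg_cong[where f=card])
  moreover have "rk M (S \<inter> ground M) \<le> card (S \<inter> ground M)" by (rule rk_le_card[OF M]) simp
  moreover have "rk N (S \<inter> ground N) \<le> card (S \<inter> ground N)" by (rule rk_le_card[OF N]) simp
  ultimately show "rk (direct_sum M N) S \<le> card S"
    using S by (simp add: rk_direct_sum)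
next
  fix S T assume ST: "S \<subseteq> T \<and> T \<subseteq> ground (direct_sum M N)"
  have "rk M (S \<inter> ground M) \<le> rk M (T \<inter> ground M)" by (rule rk_mono[OF M]) (use ST in auto)
  moreover have "rk N (S \<inter> ground N) \<le> rk N (T \<inter> ground N)" by (rule rk_mono[OF N]) (use ST in auto)
  moreover have "S \<subseteq> ground M \<union> ground N" using ST by auto
  ultimately show "rk (direct_sum M N) S \<le> rk (direct_sum M N) T"
    using ST by (simp add: rk_direct_sum)
next
  fix S T assume ST: "S \<subseteq> ground (direct_sum M N) \<and> T \<subseteq> ground (direct_sum M N)"
  have "rk K ((S \<union> T) \<inter> ground K) + rk K ((S \<inter> T) \<inter> ground K) \<le> rk K (S \<inter> ground K) + rk K (T \<inter> ground K)"
    if "matroid K" for K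
  proof -
    have "(S \<union> T) \<inter> ground K = (S \<inter> ground K) \<union> (T \<inter> ground K)"
      "(S \<inter> T) \<inter> ground K = (S \<inter> ground K) \<inter> (T \<inter> ground K)" by auto
    then show ?thesis using rk_submodular[OF that, of "S \<inter> ground K" "T \<inter> ground K"] by simp
  qed
  note this[OF M] this[OF N]
  moreover have "S \<union> T \<subseteq> ground M \<union> ground N" "S \<inter> T \<subseteq> ground M \<union> ground N" using ST by auto
  ultimately show "rk (direct_sum M N) (S \<union> T) + rk (direct_sum M N) (S \<inter> T)
      \<le> rk (direct_sum M N) S + rk (direct_sum M N) T"
    using ST by (simp add: rk_direct_sum)
qed

section \<open>Successive identifications of independent sets\<close>

lemma rk_identify_insert_eq_Suc:
  assumes M: "matroid M" and xy: "independent_in M {x, y}" "x \<noteq> y" and S: "S \<subseteq> ground M - {y}"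
    and z: "z \<in> {x, y}" "rk M (insert z S) = Suc (rk M S)"
  shows "rk (identify M x y) S = rk M S"
proof -
  have "rk M (insert z S) \<le> rk M (S \<union> {x, y})"
    by (rule rk_mono[OF M]) (use xy S z in \<open>auto simp: independent_in_def\<close>)
  then show ?thesis unfolding rk_identify[OF M xy S] using z by simp
qed

text \<open>
  After the identification \<open>x\<close> stands for \<open>y\<close>: it may replace \<open>y\<close> in sets that together with \<open>y\<close> do not
  span \<open>x\<close>.
\<close>

lemma rk_identify_insert_left:
  assumes M: "matroid M" and xy: "independent_in M {x, y}" "x \<noteq> y" 
    and S: "S \<subseteq> ground M" "rk M (insert x (insert y S)) = Suc (rk M (insert y S))"
    and y: "y \<notin> S"
  shows "rk (identify M x y) (insert x S) = rk M (insert y S)"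
proof -
  have P: "x \<in> ground M" "y \<in> ground M" using xy by (auto simp: independent_in_def)
  have sub: "insert x S \<subseteq> ground M - {y}" using S y xy P by auto
  have x: "rk M (insert x S) = Suc (rk M S)"
    by (rule rk_insert_subset[OF M _ _ S(2)]) (use S P in auto)
  have "rk M (S \<union> {y}) \<le> rk M S + card {y}"
    by (rule rk_union_le_add[OF M]) (use S P in auto)
  moreover have "insert x S \<union> {x, y} = insert x (insert y S)" by auto
  ultimately show ?thesis
    unfolding rk_identify[OF M xy sub] using x S(2) by simp
qed

text \<open>
  The state after \<open>j\<close> identifications. The second and third condition say that both factors survive as restrictions,
  \<open>\<phi>\<close> renaming the \<open>x\<close> to the \<open>y\<close>. The last two carry the induction: the remaining \<open>y\<close> are independent over
  the first factor, and the remaining \<open>x\<close> over the second. Hence the next \<open>y\<close> lies outside the span of the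
  first factor and the next \<open>x\<close> outside that of the second, which is why identifying them changes neither.
\<close>

definition identification_stage ::
  "'a ranked_set \<Rightarrow> 'a ranked_set \<Rightarrow> 'a list \<Rightarrow> 'a list \<Rightarrow> ('a \<Rightarrow> 'a) \<Rightarrow> nat \<Rightarrow> 'a ranked_set \<Rightarrow> bool" where
  "identification_stage M\<^sub>1 M\<^sub>2 xs ys \<phi> j N \<longleftrightarrow>
     ground N = ground M\<^sub>1 \<union> (ground M\<^sub>2 - set (take j ys)) \<and>
     (\<forall>S\<subseteq>ground M\<^sub>1. rk N S = rk M\<^sub>1 S) \<and>
     (\<forall>S\<subseteq>(ground M\<^sub>2 - set (take j ys)) \<union> set (take j xs). rk N S = rk M\<^sub>2 (\<phi> ` S)) \<and>
     rk N (ground M\<^sub>1 \<union> set (drop j ys)) = total_rank M\<^sub>1 + (length ys - j) \<and>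
     rk N ((ground M\<^sub>2 - set (take j ys)) \<union> set xs) = total_rank M\<^sub>2 + (length xs - j)"

lemma identification_stage_0:
  assumes M: "matroid M\<^sub>1" "matroid M\<^sub>2" and disj: "ground M\<^sub>1 \<inter> ground M\<^sub>2 = {}"
    and xs: "distinct xs" "independent_in M\<^sub>1 (set xs)" and ys: "distinct ys" "independent_in M\<^sub>2 (set ys)"
    and \<phi>: "\<And>e. e \<in> ground M\<^sub>2 \<Longrightarrow> \<phi> e = e"
  shows "identification_stage M\<^sub>1 M\<^sub>2 xs ys \<phi> 0 (direct_sum M\<^sub>1 M\<^sub>2)"
proof -
  have sub: "set xs \<subseteq> ground M\<^sub>1" "set ys \<subseteq> ground M\<^sub>2"
    using xs ys by (auto simp: independent_in_def)
  have "rk (direct_sum M\<^sub>1 M\<^sub>2) S = rk M\<^sub>1 S" if "S \<subseteq> ground M\<^sub>1" for S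
  proof -
    have "S \<inter> ground M\<^sub>1 = S" "S \<inter> ground M\<^sub>2 = {}" "S \<subseteq> ground M\<^sub>1 \<union> ground M\<^sub>2" using that disj by auto
    then show ?thesis by (simp add: rk_direct_sum rk_empty[OF M(2)])
  qed
  moreover have "rk (direct_sum M\<^sub>1 M\<^sub>2) S = rk M\<^sub>2 (\<phi> ` S)" if "S \<subseteq> ground M\<^sub>2" for S
  proof -
    have "S \<inter> ground M\<^sub>1 = {}" "S \<inter> ground M\<^sub>2 = S" "S \<subseteq> ground M\<^sub>1 \<union> ground M\<^sub>2" using that disj by auto
    moreover have "\<phi> ` S = S" using \<phi> that by force
    ultimately show ?thesis by (simp add: rk_direct_sum rk_empty[OF M(1)])
  qed
  moreover have "rk (direct_sum M\<^sub>1 M\<^sub>2) (ground M\<^sub>1 \<union> set ys) = total_rank M\<^sub>1 + length ys"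
  proof -
    have "(ground M\<^sub>1 \<union> set ys) \<inter> ground M\<^sub>1 = ground M\<^sub>1" "(ground M\<^sub>1 \<union> set ys) \<inter> ground M\<^sub>2 = set ys"
      "ground M\<^sub>1 \<union> set ys \<subseteq> ground M\<^sub>1 \<union> ground M\<^sub>2" using sub disj by auto
    then show ?thesis
      using ys by (simp add: rk_direct_sum total_rank_def independent_in_def distinct_card)
  qed
  moreover have "rk (direct_sum M\<^sub>1 M\<^sub>2) (ground M\<^sub>2 \<union> set xs) = total_rank M\<^sub>2 + length xs"
  proof -
    have "(ground M\<^sub>2 \<union> set xs) \<inter> ground M\<^sub>2 = ground M\<^sub>2" "(ground M\<^sub>2 \<union> set xs) \<inter> ground M\<^sub>1 = set xs"
      "ground M\<^sub>2 \<union> set xs \<subseteq> ground M\<^sub>1 \<union> ground M\<^sub>2" using sub disj by auto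
    then show ?thesis
      using xs by (simp add: rk_direct_sum total_rank_def independent_in_def distinct_card)
  qed
  ultimately show ?thesis by (simp add: identification_stage_def)
qed

lemma identification_stage_Suc:
  assumes M: "matroid M\<^sub>1" "matroid M\<^sub>2" and disj: "ground M\<^sub>1 \<inter> ground M\<^sub>2 = {}"
    and xs: "distinct xs" "independent_in M\<^sub>1 (set xs)" and ys: "distinct ys" "independent_in M\<^sub>2 (set ys)"
    and len: "length xs = length ys"
    and \<phi>: "\<And>e. e \<in> ground M\<^sub>2 \<Longrightarrow> \<phi> e = e" "\<And>i. i < length ys \<Longrightarrow> \<phi> (xs ! i) = ys ! i"
    and j: "j < length ys" and N: "matroid N"
    and stage: "identification_stage M\<^sub>1 M\<^sub>2 xs ys \<phi> j N"
  shows "independent_in N {xs ! j, ys ! j}"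
    and "identification_stage M\<^sub>1 M\<^sub>2 xs ys \<phi> (Suc j) (identify N (xs ! j) (ys ! j))"
proof -
  define x y where "x = xs ! j" and "y = ys ! j"
  define F where "F = ground M\<^sub>2 - set (take j ys)"
  define T where "T = set (take j xs)"
  define T' where "T' = set (drop (Suc j) xs)"
  define R where "R = set (drop (Suc j) ys)"
  have sub: "set xs \<subseteq> ground M\<^sub>1" "set ys \<subseteq> ground M\<^sub>2"
    using xs ys by (auto simp: independent_in_def)
  have xin: "x \<in> set xs" "x \<in> ground M\<^sub>1" and yin: "y \<in> set ys" "y \<in> ground M\<^sub>2"
    using sub j len by (auto simp: x_def y_def)
  have xy_ne: "x \<noteq> y" using xin yin disj by auto
  have take_xs: "set (take (Suc j) xs) = insert x T" and take_ys: "set (take (Suc j) ys) = insert y (set (take j ys))"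
    using j len by (auto simp: take_Suc_conv_app_nth x_def y_def T_def)
  have drop_ys: "set (drop j ys) = insert y R" and drop_xs: "set (drop j xs) = insert x T'"
    using j len Cons_nth_drop_Suc[of j ys, symmetric] Cons_nth_drop_Suc[of j xs, symmetric] 
    by (simp_all add: x_def y_def R_def T'_def)
  have y_notin: "y \<notin> set (take j ys)" "y \<notin> R"
    using ys(1) j by (auto simp: y_def R_def in_set_conv_nth nth_eq_iff_index_eq)
  have x_notin: "x \<notin> T" "x \<notin> T'"
    using xs(1) j len by (auto simp: x_def T_def T'_def in_set_conv_nth nth_eq_iff_index_eq)
  have set_xs: "set xs = T \<union> insert x T'"
    unfolding T_def drop_xs[symmetric] by (metis append_take_drop_id set_append)
  have yF: "y \<in> F" using yin y_notin by (simp add: F_def)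
  have R_sub: "R \<subseteq> set ys" "R \<subseteq> F"
  proof -
    show "R \<subseteq> set ys" unfolding R_def by (rule set_drop_subset)
    moreover have "set (take j ys) \<inter> set (drop j ys) = {}"
      using ys(1) by (metis append_take_drop_id distinct_append)
    ultimately show "R \<subseteq> F" using sub drop_ys by (auto simp: F_def)
  qed
  have gN: "ground N = ground M\<^sub>1 \<union> F"
    and rk1: "\<And>S. S \<subseteq> ground M\<^sub>1 \<Longrightarrow> rk N S = rk M\<^sub>1 S"
    and rk2: "\<And>S. S \<subseteq> F \<union> T \<Longrightarrow> rk N S = rk M\<^sub>2 (\<phi> ` S)"
    and tot1: "rk N (ground M\<^sub>1 \<union> insert y R) = total_rank M\<^sub>1 + (length ys - j)"
    and tot2: "rk N (F \<union> set xs) = total_rank M\<^sub>2 + (length xs - j)"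
    using stage unfolding identification_stage_def drop_ys by (simp_all add: F_def T_def)
  have FT: "F \<union> T \<subseteq> ground N" using gN sub set_xs by auto
  have card_R: "card (insert y R) = length ys - j"
    using ys(1) unfolding drop_ys[symmetric] by (simp add: distinct_card)
  have card_T': "card (insert x T') = length xs - j"
    using xs(1) unfolding drop_xs[symmetric] by (simp add: distinct_card)
  \<comment> \<open>By the rank of the first factor together with the remaining \<open>y\<close>, the next one is free over all the rest.\<close>
  have y_free_all: "rk N (ground M\<^sub>1 \<union> R) = total_rank M\<^sub>1 + (length ys - Suc j)"
    "rk N (insert y (ground M\<^sub>1 \<union> R)) = Suc (rk N (ground M\<^sub>1 \<union> R))"
  proof -
    have "ground M\<^sub>1 \<subseteq> ground N" "insert y R \<subseteq> ground N" using gN R_sub yF by auto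
    note * = rk_insert_of_rk_union_eq[OF N this(1) this(2) _ insertI1]
    have "rk N (ground M\<^sub>1) = total_rank M\<^sub>1" by (simp add: rk1 total_rank_def)
    moreover have "insert y R - {y} = R" using y_notin by auto
    ultimately show "rk N (ground M\<^sub>1 \<union> R) = total_rank M\<^sub>1 + (length ys - Suc j)"
      "rk N (insert y (ground M\<^sub>1 \<union> R)) = Suc (rk N (ground M\<^sub>1 \<union> R))"
      using * tot1 card_R by (simp_all add: R_def)
  qed
  \<comment> \<open>Dually for the next \<open>x\<close> over the second factor, in which the identified \<open>x\<close> replace the \<open>y\<close>.\<close>
  have x_free_all: "rk N (insert x (F \<union> T)) = Suc (rk N (F \<union> T))"
  proof -
    have "insert x T' \<subseteq> ground N" using gN sub set_xs by auto
    note * = rk_insert_of_rk_union_eq(2)[OF N FT this _ insertI1]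
    have "\<phi> ` (F \<union> T) = ground M\<^sub>2"
    proof -
      have "\<phi> ` F = F" using \<phi>(1) by (force simp: F_def)
      moreover have "\<phi> ` T = set (take j ys)"
      proof -
        have "map \<phi> (take j xs) = take j ys"
          using j len \<phi>(2) by (intro nth_equalityI) auto
        then show ?thesis unfolding T_def by (metis set_map)
      qed
      moreover have "set (take j ys) \<subseteq> ground M\<^sub>2" using sub(2) set_take_subset by fastforce
      ultimately show ?thesis by (auto simp: image_Un F_def)
    qed
    then have "rk N (F \<union> T) = total_rank M\<^sub>2" using rk2[of "F \<union> T"] by (simp add: total_rank_def)
    moreover have "F \<union> T \<union> insert x T' = F \<union> set xs" using set_xs by auto
    moreover have "insert x T' - {x} = T'" using x_notin by auto
    ultimately have "rk N (insert x (F \<union> T \<union> T')) = Suc (rk N (F \<union> T \<union> T'))"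
      using * tot2 card_T' by (simp add: T'_def)
    then show ?thesis
      by (rule rk_insert_subset[OF N, rotated 2]) (use gN sub set_xs in auto)
  qed
  have y_free: "rk N (insert y S) = Suc (rk N S)" if "S \<subseteq> ground M\<^sub>1 \<union> R" for S
    by (rule rk_insert_subset[OF N that _ y_free_all(2)]) (use gN R_sub yF in auto)
  have x_free: "rk N (insert x S) = Suc (rk N S)" if "S \<subseteq> F \<union> T" for S
    by (rule rk_insert_subset[OF N that _ x_free_all]) (use gN FT xin in auto)
  have rk_x: "rk N {x} = 1"
    using x_free[of "{}"] rk_empty[OF N] by simp
  have "rk N {x, y} = 2"
    using y_free[of "{x}"] xin rk_x by (simp add: insert_commute)
  then have ind: "independent_in N {x, y}"
    using xin yF gN xy_ne by (simp add: independent_in_def)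
  then show "independent_in N {xs ! j, ys ! j}" by (simp add: x_def y_def)
  let ?N = "identify N x y"
  have F': "ground M\<^sub>2 - set (take (Suc j) ys) = F - {y}" by (auto simp: F_def take_ys)
  have disj': "y \<notin> ground M\<^sub>1" "F \<inter> ground M\<^sub>1 = {}" using yin disj by (auto simp: F_def)
  have "identification_stage M\<^sub>1 M\<^sub>2 xs ys \<phi> (Suc j) ?N"
    unfolding identification_stage_def F' take_xs R_def[symmetric]
  proof (intro conjI allI impI)
    show "ground ?N = ground M\<^sub>1 \<union> (F - {y})" using gN disj' by auto
  next
    fix S assume S: "S \<subseteq> ground M\<^sub>1"
    have "rk ?N S = rk N S"
      by (rule rk_identify_insert_eq_Suc[OF N ind xy_ne, of _ y]) (use S gN disj' y_free[of S] in auto)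
    then show "rk ?N S = rk M\<^sub>1 S" using rk1[OF S] by simp
  next
    fix S assume S: "S \<subseteq> F - {y} \<union> insert x T"
    have TM: "T \<subseteq> ground M\<^sub>1" using sub set_xs by auto
    then have yS: "y \<notin> S" using S xy_ne disj' by auto
    show "rk ?N S = rk M\<^sub>2 (\<phi> ` S)"
    proof (cases "x \<in> S")
      case False
      then have S': "S \<subseteq> F \<union> T" using S by auto
      have "rk ?N S = rk N S"
        by (rule rk_identify_insert_eq_Suc[OF N ind xy_ne, of _ x]) (use S' FT yS x_free[OF S'] in auto)
      then show ?thesis using rk2[OF S'] by simp
    next
      case True
      define S0 where "S0 = S - {x}"
      have SS: "S = insert x S0" using True by (auto simp: S0_def)
      have yS0: "insert y S0 \<subseteq> F \<union> T" using S yF by (auto simp: S0_def)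
      have "rk ?N (insert x S0) = rk N (insert y S0)"
        by (rule rk_identify_insert_left[OF N ind xy_ne])
           (use yS0 FT x_free[OF yS0] yS in \<open>auto simp: S0_def\<close>)
      also have "\<dots> = rk M\<^sub>2 (\<phi> ` insert y S0)" by (rule rk2[OF yS0])
      also have "\<phi> ` insert y S0 = \<phi> ` insert x S0"
        using \<phi>(1)[OF yin(2)] \<phi>(2)[OF j] by (simp add: x_def y_def)
      finally show ?thesis by (simp only: SS)
    qed
  next
    have "rk ?N (ground M\<^sub>1 \<union> R) = rk N (ground M\<^sub>1 \<union> R)"
      by (rule rk_identify_insert_eq_Suc[OF N ind xy_ne, of _ y])
         (use gN R_sub y_notin disj' y_free_all(2) in auto)
    then show "rk ?N (ground M\<^sub>1 \<union> R) = total_rank M\<^sub>1 + (length ys - Suc j)"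
      using y_free_all(1) by simp
  next
    let ?S = "F - {y} \<union> set xs"
    have S: "?S \<subseteq> ground N - {y}" "?S \<subseteq> ground N" using gN sub disj' by auto
    have "?S \<union> {x, y} = F \<union> set xs" using yF xin by auto
    then have "rk ?N ?S = min (rk N ?S) (rk N (F \<union> set xs) - 1)"
      using rk_identify[OF N ind xy_ne S(1)] by simp
    moreover have "rk N (?S \<union> {y}) \<le> rk N ?S + card {y}"
      by (rule rk_union_le_add[OF N S(2)]) (use gN yF in auto)
    moreover have "?S \<union> {y} = F \<union> set xs" using yF by auto
    ultimately show "rk ?N ?S = total_rank M\<^sub>2 + (length xs - Suc j)"
      using tot2 j len by simp
  qed
  then show "identification_stage M\<^sub>1 M\<^sub>2 xs ys \<phi> (Suc j) (identify N (xs ! j) (ys ! j))"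
    by (simp add: x_def y_def)
qed

lemma identify_list_take_Suc:
  assumes "j < length xs" "length xs = length ys"
  shows "identify_list M (take (Suc j) xs) (take (Suc j) ys) =
    identify (identify_list M (take j xs) (take j ys)) (xs ! j) (ys ! j)"
  using assms by (simp add: identify_list_def take_Suc_conv_app_nth)

section \<open>Direct sums and identifications of almost entropic matroids\<close>

lemma almost_entropic_imp_quasi_uniform_limit:
  assumes "almost_entropic M"
  shows "quasi_uniform_limit (ground M) (\<lambda>A. real (rk M A))"
proof -
  have M: "matroid M" "(\<lambda>A\<in>Pow (ground M). real (rk M A)) \<in> almost_entropic_cone (ground M)"
    using assms by (simp_all add: almost_entropic_def)
  have "quasi_uniform_limit (ground M) (\<lambda>A\<in>Pow (ground M). real (rk M A))"
    by (rule almost_entropic_cone_imp_quasi_uniform_limit[OF finite_ground[OF M(1)] M(2)])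
  then show ?thesis by (rule quasi_uniform_limit_cong) simp
qed

text \<open>
  The two families are taken independently.
\<close>

lemma almost_entropic_direct_sum:
  assumes "almost_entropic M" "almost_entropic N" and disj: "ground M \<inter> ground N = {}"
  shows "almost_entropic (direct_sum M N)"
proof -
  let ?E = "ground M \<union> ground N" and ?D = "direct_sum M N"
  have M: "matroid M" "matroid N" using assms by (simp_all add: almost_entropic_def)
  have D: "matroid ?D" by (rule matroid_direct_sum[OF M disj])
  have "quasi_uniform_limit ?E
      (\<lambda>A. real (rk M (A \<inter> ground M)) + real (rk N (A \<inter> ground N)))"
    by (intro quasi_uniform_limit_add)
       (rule quasi_uniform_limit_extend[OF almost_entropic_imp_quasi_uniform_limit], fact)+
  then have "quasi_uniform_limit ?E (\<lambda>A. real (rk ?D A))"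
    by (rule quasi_uniform_limit_cong) (simp add: rk_direct_sum)
  \<comment> \<open>With \<open>L = {}\<close> and \<open>t = 0\<close> the quotient lemma returns the function itself.\<close>
  then have "(\<lambda>A\<in>Pow ?E. min (real (rk ?D A)) (real (rk ?D (A \<union> {})) - 0)) \<in> almost_entropic_cone ?E"
    using finite_ground[OF M(1)] finite_ground[OF M(2)]
    by (intro principal_quotient_in_almost_entropic_cone[where E = ?E and h = "\<lambda>A. real (rk ?D A)"]) auto
  then show ?thesis using D by (simp add: almost_entropic_def)
qed

text \<open>
  The quotient lemma for \<open>L = {x, y}\<close> and \<open>t = 1\<close>; deleting \<open>y\<close> is the passage to subsets of the
  smaller ground set.
\<close>

lemma almost_entropic_identify:
  assumes M: "almost_entropic M" and xy: "independent_in M {x, y}" "x \<noteq> y"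
  shows "almost_entropic (identify M x y)"
proof -
  let ?E = "ground M" and ?E' = "ground M - {y}" and ?I = "identify M x y"
  have mat: "matroid M" using M by (simp add: almost_entropic_def)
  have P: "{x, y} \<subseteq> ?E" "rk M {x, y} = 2" using xy by (auto simp: independent_in_def)
  have "(\<lambda>A\<in>Pow ?E'. min (real (rk M A)) (real (rk M (A \<union> {x, y})) - 1)) \<in> almost_entropic_cone ?E'"
    using almost_entropic_imp_quasi_uniform_limit[OF M] finite_ground[OF mat] P
    by (intro principal_quotient_in_almost_entropic_cone[where E = ?E and h = "\<lambda>A. real (rk M A)"]) auto
  moreover have "min (real (rk M A)) (real (rk M (A \<union> {x, y})) - 1) = real (rk ?I A)"
    if A: "A \<in> Pow ?E'" for A
  proof -
    have "rk M {x, y} \<le> rk M (A \<union> {x, y})" by (rule rk_mono[OF mat]) (use A P in auto)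
    then have "real (rk M (A \<union> {x, y})) - 1 = real (rk M (A \<union> {x, y}) - 1)" using P by simp
    then show ?thesis using rk_identify[OF mat xy] A by (simp only: of_nat_min Pow_iff)
  qed
  ultimately have "(\<lambda>A\<in>Pow ?E'. real (rk ?I A)) \<in> almost_entropic_cone ?E'"
    by (simp cong: restrict_cong)
  then show ?thesis using matroid_identify[OF mat xy] by (simp add: almost_entropic_def)
qed

lemma ranked_set_eqI:
  assumes "ground M = ground N" "\<And>S. S \<subseteq> ground N \<Longrightarrow> rk M S = rk N S"
    and "rk M \<in> extensional (Pow (ground M))" "rk N \<in> extensional (Pow (ground N))"
  shows "M = N"
proof (rule ranked_set.expand, intro conjI)
  show "rk M = rk N"
    by (rule extensionalityI[OF assms(3)[unfolded assms(1)] assms(4)]) (simp add: assms(2))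
qed fact

lemma ground_restriction: "S \<subseteq> ground M \<Longrightarrow> ground (restriction M S) = S"
  by (auto simp: restriction_def delete_def)

lemma rk_restriction: "S \<subseteq> ground M \<Longrightarrow> T \<subseteq> S \<Longrightarrow> rk (restriction M S) T = rk M T"
  unfolding restriction_def delete_def by (subst rk_mk_ranked) auto

theorem proposition5p2:
  fixes M\<^sub>1 M\<^sub>2 W :: "'a ranked_set" and xs ys :: "'a list" and k r :: nat
  assumes "almost_entropic M\<^sub>1" and "almost_entropic M\<^sub>2"
    and "ground M\<^sub>1 \<inter> ground M\<^sub>2 = {}"
    and "length xs = k" and "distinct xs" and "independent_in M\<^sub>1 (set xs)"
    and "length ys = k" and "distinct ys" and "independent_in M\<^sub>2 (set ys)"
    and "W = identify_list (direct_sum M\<^sub>1 M\<^sub>2) xs ys"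
  shows "(\<forall>j<k. independent_in
             (identify_list (direct_sum M\<^sub>1 M\<^sub>2) (take j xs) (take j ys)) {xs ! j, ys ! j}) \<and>
         almost_entropic W \<and>
         restriction W (ground M\<^sub>1) = M\<^sub>1 \<and>
         (\<exists>\<phi>. (\<forall>j<k. \<phi> (xs ! j) = ys ! j) \<and>
              (\<forall>e \<in> ground M\<^sub>2 - set ys. \<phi> e = e) \<and>
              matroid_iso \<phi> (restriction W ((ground M\<^sub>2 - set ys) \<union> set xs)) M\<^sub>2) \<and>
         (total_rank M\<^sub>1 = r \<and> total_rank M\<^sub>2 = r \<and> k = r \<and>
          basis_of M\<^sub>1 (set xs) \<and> basis_of M\<^sub>2 (set ys) \<longrightarrow>
            total_rank W = r \<and>
            spanning_in W (ground M\<^sub>1) \<and>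
            spanning_in W ((ground M\<^sub>2 - set ys) \<union> set xs))"
proof -
  note ae = assms(1,2) and disj = assms(3) and xs = assms(5,6) and ys = assms(8,9)
  have M: "matroid M\<^sub>1" "matroid M\<^sub>2" using ae by (simp_all add: almost_entropic_def)
  have len: "length xs = length ys" and k: "length ys = k" using assms(4,7) by simp_all
  have sub: "set xs \<subseteq> ground M\<^sub>1" "set ys \<subseteq> ground M\<^sub>2"
    using xs ys by (auto simp: independent_in_def)
  define \<phi> where "\<phi> = (\<lambda>e. case map_of (zip xs ys) e of None \<Rightarrow> e | Some y \<Rightarrow> y)"
  have \<phi>_xs: "\<phi> (xs ! i) = ys ! i" if "i < length ys" for i
    using that len xs(1) by (simp add: \<phi>_def map_of_zip_nth)
  have \<phi>_id: "\<phi> e = e" if "e \<in> ground M\<^sub>2" for e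
  proof -
    have "e \<notin> set xs" using that sub disj by auto
    then have "map_of (zip xs ys) e = None" by (simp add: map_of_zip_is_None[OF len])
    then show ?thesis by (simp add: \<phi>_def)
  qed
  define N where "N = (\<lambda>j. identify_list (direct_sum M\<^sub>1 M\<^sub>2) (take j xs) (take j ys))"
  note stage_Suc = identification_stage_Suc[OF M disj xs ys len \<phi>_id \<phi>_xs]
  have stage: "almost_entropic (N j) \<and> identification_stage M\<^sub>1 M\<^sub>2 xs ys \<phi> j (N j)" if "j \<le> length ys" for j
    using that
  proof (induction j)
    case 0
    have "N 0 = direct_sum M\<^sub>1 M\<^sub>2" by (simp add: N_def identify_list_def)
    then show ?case
      using almost_entropic_direct_sum[OF ae disj] identification_stage_0[OF M disj xs ys \<phi>_id] by simp
  next
    case (Suc j)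
    then have j: "j < length ys" and IH: "almost_entropic (N j)" "identification_stage M\<^sub>1 M\<^sub>2 xs ys \<phi> j (N j)"
      by simp_all
    have mat: "matroid (N j)" using IH(1) by (simp add: almost_entropic_def)
    have "xs ! j \<noteq> ys ! j" using sub disj j len nth_mem by (metis IntI empty_iff subsetD)
    then have "almost_entropic (identify (N j) (xs ! j) (ys ! j))"
      by (intro almost_entropic_identify IH(1) stage_Suc(1)[OF _ _ j mat IH(2)])
    moreover have "N (Suc j) = identify (N j) (xs ! j) (ys ! j)"
      unfolding N_def using j len by (intro identify_list_take_Suc) simp_all
    ultimately show ?case using stage_Suc(2)[OF _ _ j mat IH(2)] by simp
  qed
  have W: "W = N (length ys)" using assms(10) len by (simp add: N_def)
  define F where "F = (ground M\<^sub>2 - set ys) \<union> set xs"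
  have aeW: "almost_entropic W" and matW: "matroid W"
    using stage[of "length ys"] W by (simp_all add: almost_entropic_def)
  have gW: "ground W = ground M\<^sub>1 \<union> (ground M\<^sub>2 - set ys)"
    and rk1: "\<And>S. S \<subseteq> ground M\<^sub>1 \<Longrightarrow> rk W S = rk M\<^sub>1 S"
    and rk2: "\<And>S. S \<subseteq> F \<Longrightarrow> rk W S = rk M\<^sub>2 (\<phi> ` S)"
    and tot2: "rk W F = total_rank M\<^sub>2"
    using stage[of "length ys"] W len unfolding identification_stage_def F_def by simp_all
  have sub1: "ground M\<^sub>1 \<subseteq> ground W" and subF: "F \<subseteq> ground W"
    using gW sub by (auto simp: F_def)
  have ind: "independent_in (N j) {xs ! j, ys ! j}" if "j < k" for j
    using stage_Suc(1)[of j "N j"] stage[of j] that k by (simp add: almost_entropic_def)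
  have res: "restriction W (ground M\<^sub>1) = M\<^sub>1"
  proof (rule ranked_set_eqI)
    show "rk (restriction W (ground M\<^sub>1)) \<in> extensional (Pow (ground (restriction W (ground M\<^sub>1))))"
      unfolding restriction_def delete_def by (rule rk_mk_ranked_extensional)
    show "rk M\<^sub>1 \<in> extensional (Pow (ground M\<^sub>1))" using M by (simp add: matroid_def)
  qed (simp_all add: ground_restriction rk_restriction sub1 rk1)
  have "bij_betw \<phi> F (ground M\<^sub>2)"
  proof -
    have "map \<phi> xs = ys" using \<phi>_xs len by (intro nth_equalityI) auto
    then have "bij_betw \<phi> (set xs) (set ys)"
      using ys(1) by (auto simp: bij_betw_def distinct_map)
    moreover have "bij_betw \<phi> (ground M\<^sub>2 - set ys) (ground M\<^sub>2 - set ys)"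
      using \<phi>_id by (subst bij_betw_cong[where g = id]) auto
    ultimately have "bij_betw \<phi> ((ground M\<^sub>2 - set ys) \<union> set xs) ((ground M\<^sub>2 - set ys) \<union> set ys)"
      by (intro bij_betw_combine) auto
    moreover have "(ground M\<^sub>2 - set ys) \<union> set ys = ground M\<^sub>2" using sub by auto
    ultimately show ?thesis by (simp add: F_def)
  qed
  then have iso: "matroid_iso \<phi> (restriction W F) M\<^sub>2"
    unfolding matroid_iso_def using subF rk2 by (simp add: ground_restriction rk_restriction)
  \<comment> \<open>The two restrictions have rank \<open>r\<close> and share the set of all \<open>x\<close>, again of rank \<open>r\<close>, so by
    submodularity their union, which is the ground set, has rank at most \<open>r\<close>.\<close>
  have span: "total_rank W = r \<and> spanning_in W (ground M\<^sub>1) \<and> spanning_in W F"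
    if r: "total_rank M\<^sub>1 = r" "total_rank M\<^sub>2 = r" "k = r"
  proof -
    have r1: "rk W (ground M\<^sub>1) = r" using rk1 r(1) by (simp add: total_rank_def)
    have rF: "rk W F = r" using tot2 r(2) by simp
    have "rk W (set xs) = r" 
      using rk1[OF sub(1)] xs r(3) assms(4) by (simp add: independent_in_def distinct_card)
    moreover have "rk W (set xs) \<le> rk W (ground M\<^sub>1 \<inter> F)"
      by (rule rk_mono[OF matW]) (use sub sub1 in \<open>auto simp: F_def\<close>)
    moreover have "rk W (ground M\<^sub>1 \<union> F) + rk W (ground M\<^sub>1 \<inter> F) \<le> rk W (ground M\<^sub>1) + rk W F"
      by (rule rk_submodular[OF matW sub1 subF])
    moreover have "ground M\<^sub>1 \<union> F = ground W" using gW sub by (auto simp: F_def)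
    ultimately have "rk W (ground W) \<le> r" using r1 rF by simp
    moreover have "rk W (ground M\<^sub>1) \<le> rk W (ground W)" by (rule rk_mono[OF matW sub1]) simp
    ultimately have "total_rank W = r" using r1 by (simp add: total_rank_def)
    then show ?thesis using r1 rF sub1 subF by (simp add: spanning_in_def)
  qed
  show ?thesis
    using ind aeW res iso span \<phi>_xs \<phi>_id k unfolding N_def F_def by (intro conjI exI[of _ \<phi>]) auto
qed

end
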